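(* Let $T>0$, $\alpha\in(0,1)$, let $h=1/N_h$ and $\Delta t=T/N$ with $N_h,N$ positive integers. Let $g$ be an admissible numerical Hamiltonian and $f_h$ an admissible discrete coupling (both defined in the context). Let $u_T:\mathbb{T}^2\to\mathbb{R}$ and let $m_0\in L^1(\mathbb{T}^2)$ with $m_0\ge 0$ and $\int_{\mathbb{T}^2}m_0\,dx=1$. Then there is at most one pair $(U,M)$, with $U=(U^n)_{0\le n\le N}$ and $M=(M^n)_{0\le n\le N}$ families of grid functions on $\mathbb{T}^2_h$, satisfying for all $n=0,\dots,N-1$ and all $i,j$ $$\begin{cases}\bar D_{\Delta t}^{\alpha} U_{i,j}^{n} - (\Delta_h U^{n})_{i,j} + g(x_{i,j},[D_hU^{n}]_{i,j}) = f_h[M^{n+1}]_{i,j},\\ D_{\Delta t}^\alpha M_{i,j}^{n+1} - (\Delta_h M^{n+1})_{i,j} - \mathcal{B}_{i,j}(U^{n},M^{n+1}) = 0,\\ U^{N}_{i,j} = u_T(x_{i,j}),\qquad M_{i,j}^{0}= \frac 1 {h^2} \int_{|x-x_{i,j}|_{\infty}\le h/2} m_0(x)\, dx.\end{cases}$$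
   Context: Grid: $\mathbb{T}^2$ is the unit torus in $\mathbb{R}^2$, $\mathbb{T}^2_h$ the uniform grid of points $x_{i,j}=(ih,jh)$, $h=1/N_h$, with indices $i,j$ taken modulo $N_h$. A grid function is $U=(U_{i,j})$ on $\mathbb{T}^2_h$; $(U,V)_2=h^2\sum_{i,j}U_{i,j}V_{i,j}$, $\|U\|_\infty=\max_{i,j}|U_{i,j}|$; $\overline 1$ is the grid function constantly equal to $1$; $\mathcal{K}_h=\{M: (M,\overline 1)_2=1,\ M_{i,j}\ge 0\}$. Discrete Caputo derivatives (L1 scheme): with $\rho_\alpha=\Gamma(2-\alpha)\Delta t^\alpha$, $D_{\Delta t}^{\alpha} M^{n} = \frac{1}{\rho_\alpha} ( M^{n} - \sum_{k=0}^{n-1} c_k^{n} M^{k})$ for $1\le n\le N$ and $\bar D_{\Delta t}^{\alpha} U^{n} = \frac{1}{\rho_\alpha}( U^{n} - \sum_{k=n+1}^{N} \bar c_{n}^k U^k)$ for $0\le n\le N-1$, where $c_0^n=n^{1-\alpha}-(n-1)^{1-\alpha}$, $c_k^n=2(n-k)^{1-\alpha} - (n+1-k)^{1-\alpha} - (n-1-k)^{1-\alpha}$ for $1\le k\le n-1$; $\bar c_n^k=2(k-n)^{1-\alpha} - (k+1-n)^{1-\alpha} - (k-1-n)^{1-\alpha}$ for $n+1\le k\le N-1$, $\bar c_n^N=(N-n)^{1-\alpha}-(N-1-n)^{1-\alpha}$. Space operators: $(D_1^+U)_{i,j}=(U_{i+1,j}-U_{i,j})/h$, $(D_2^+U)_{i,j}=(U_{i,j+1}-U_{i,j})/h$,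 $[D_hU]_{i,j}=((D_1^+U)_{i,j},(D_1^+U)_{i-1,j},(D_2^+U)_{i,j},(D_2^+U)_{i,j-1})^T\in\mathbb{R}^4$, $(\Delta_hU)_{i,j}=-\frac1{h^2}(4U_{i,j}-U_{i+1,j}-U_{i-1,j}-U_{i,j+1}-U_{i,j-1})$. Admissible numerical Hamiltonian: given a Hamiltonian $H:\mathbb{T}^2\times\mathbb{R}^2\to\mathbb{R}$, a function $g:\mathbb{T}^2\times\mathbb{R}^4\to\mathbb{R}$, $(x,q_1,q_2,q_3,q_4)\mapsto g(x,q_1,q_2,q_3,q_4)$, such that: $g$ is nonincreasing in $q_1,q_3$ and nondecreasing in $q_2,q_4$; $g(x,q_1,q_1,q_2,q_2)=H(x,(q_1,q_2))$; $g$ is of class $C^1$; $q\mapsto g(x,q)$ is convex. Transport operator: writing $g^{(\ell)}_{i,j}=\frac{\partial g}{\partial q_\ell}(x_{i,j},[D_hU]_{i,j})$, $\mathcal{B}_{i,j}(U,M)=\frac1h\big(M_{i,j}g^{(1)}_{i,j}-M_{i-1,j}g^{(1)}_{i-1,j}+M_{i+1,j}g^{(2)}_{i+1,j}-M_{i,j}g^{(2)}_{i,j}+M_{i,j}g^{(3)}_{i,j}-M_{i,j-1}g^{(3)}_{i,j-1}+M_{i,j+1}g^{(4)}_{i,j+1}-M_{i,j}g^{(4)}_{i,j}\big)$. Admissible discrete coupling: let $f$ be an operator sending functions $m$ on $\mathbb{T}^2$ (in a class containing $\mathcal{K}=\{m\in L^1(\mathbb{T}^2):m\ge0,\int_{\mathbb{T}^2}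 m=1\}$) to functions $f[m]$ on $\mathbb{T}^2$. For a grid function $M$, let $m_h$ be the piecewise constant function with value $M_{i,j}$ on $|x-x_{i,j}|_\infty\le h/2$, and $(f_h[M])_{i,j}=f[m_h](x_{i,j})$ (defined whenever $m_h$ is in the class, in particular for $M\in\mathcal{K}_h$). It is assumed that: $f_h$ is continuous on $\mathcal{K}_h$ and maps $\mathcal{K}_h$ to a bounded set of grid functions; for $M,\bar M\in\mathcal{K}_h$, $(f_h[M]-f_h[\bar M],M-\bar M)_2\le0$ implies $M=\bar M$; there is $C$ independent of $h$ with $\|f_h[M]\|_\infty\le C$ and $|f_h[M]_{i,j}-f_h[M]_{\bar i,\bar j}|\le C|x_{i,j}-x_{\bar i,\bar j}|$ for all $M\in\mathcal{K}_h$ and all indices; and $\lim_{h\to0}\sup_{m\in\mathcal{K}}\max_{i,j}|f[m](x_{i,j})-f_h[M_h]_{i,j}|=0$, where $(M_h)_{i,j}=\frac1{h^2}\int_{|x-x_{i,j}|_\infty\le h/2}m\,dx$. *)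

theory Defs
  imports "HOL-Analysis.Analysis"
begin

text \<open>
  Functions on the unit torus are functions on the plane that are \<open>1\<close>-periodic in both
  coordinates; integrals over the torus are integrals over a unit square.
\<close>

type_synonym point = "real \<times> real"

definition torus_periodic :: "(point \<Rightarrow> 'a) \<Rightarrow> bool" where
  "torus_periodic F \<longleftrightarrow> (\<forall>x. F (x + (1, 0)) = F x \<and> F (x + (0, 1)) = F x)"

definition torus_densities :: "(point \<Rightarrow> real) set" where
  "torus_densities = {m. torus_periodic m \<and> set_integrable lebesgue (cbox (0, 0) (1, 1)) m \<and>
     (AE x in lebesgue. 0 \<le> m x) \<and> (LINT x:cbox (0, 0) (1, 1)|lebesgue. m x) = 1}"

text \<open>
  The mesh size is \<open>h = 1 / Nh\<close>. Grid functions are indexed by all pairs of integers and are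
  \<open>Nh\<close>-periodic in both indices, which implements indices modulo \<open>Nh\<close>.
\<close>

type_synonym gridfun = "int \<Rightarrow> int \<Rightarrow> real"

definition mesh :: "nat \<Rightarrow> real" where
  "mesh Nh = 1 / real Nh"

definition node :: "nat \<Rightarrow> int \<Rightarrow> int \<Rightarrow> point" where
  "node Nh i j = (of_int i * mesh Nh, of_int j * mesh Nh)"

definition grid_functions :: "nat \<Rightarrow> gridfun set" where
  "grid_functions Nh = {U. \<forall>i j. U (i + int Nh) j = U i j \<and> U i (j + int Nh) = U i j}"

definition grid_inner :: "nat \<Rightarrow> gridfun \<Rightarrow> gridfun \<Rightarrow> real" where
  "grid_inner Nh U V = (mesh Nh)\<^sup>2 * (\<Sum>i\<in>{0..<int Nh}. \<Sum>j\<in>{0..<int Nh}. U i j * V i j)"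

definition grid_norm_inf :: "nat \<Rightarrow> gridfun \<Rightarrow> real" where
  "grid_norm_inf Nh U = Max ((\<lambda>(i, j). \<bar>U i j\<bar>) ` ({0..<int Nh} \<times> {0..<int Nh}))"

definition grid_densities :: "nat \<Rightarrow> gridfun set" where
  "grid_densities Nh = {M \<in> grid_functions Nh. grid_inner Nh M (\<lambda>i j. 1) = 1 \<and> (\<forall>i j. 0 \<le> M i j)}"

definition cell :: "nat \<Rightarrow> int \<Rightarrow> int \<Rightarrow> point set" where
  "cell Nh i j = {x. infnorm (x - node Nh i j) \<le> mesh Nh / 2}"

definition cell_average :: "nat \<Rightarrow> (point \<Rightarrow> real) \<Rightarrow> gridfun" where
  "cell_average Nh m i j = 1 / (mesh Nh)\<^sup>2 * (LINT x:cell Nh i j|lebesgue. m x)"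

text \<open>
  \<open>round\<close> picks the index of a cell containing the point; on the (null) set of common cell
  boundaries it rounds up.
\<close>

definition piecewise_const :: "nat \<Rightarrow> gridfun \<Rightarrow> point \<Rightarrow> real" where
  "piecewise_const Nh M x = M (round (fst x / mesh Nh)) (round (snd x / mesh Nh))"

definition caputo_scale :: "real \<Rightarrow> real \<Rightarrow> real" where
  "caputo_scale \<alpha> dt = Gamma (2 - \<alpha>) * dt powr \<alpha>"

text \<open>Below, \<open>c_fwd \<alpha> n k\<close> is $c_k^n$ and \<open>c_bwd \<alpha> N n k\<close> is $\bar c_n^k$; \<open>0 powr (1 - \<alpha>) = 0\<close>.\<close>

definition c_fwd :: "real \<Rightarrow> nat \<Rightarrow> nat \<Rightarrow> real" where
  "c_fwd \<alpha> n k =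
     (if k = 0 then real n powr (1 - \<alpha>) - (real n - 1) powr (1 - \<alpha>)
      else 2 * (real n - real k) powr (1 - \<alpha>) - (real n + 1 - real k) powr (1 - \<alpha>)
             - (real n - 1 - real k) powr (1 - \<alpha>))"

definition c_bwd :: "real \<Rightarrow> nat \<Rightarrow> nat \<Rightarrow> nat \<Rightarrow> real" where
  "c_bwd \<alpha> N n k =
     (if k = N then (real N - real n) powr (1 - \<alpha>) - (real N - 1 - real n) powr (1 - \<alpha>)
      else 2 * (real k - real n) powr (1 - \<alpha>) - (real k + 1 - real n) powr (1 - \<alpha>)
             - (real k - 1 - real n) powr (1 - \<alpha>))"

definition caputo_fwd :: "real \<Rightarrow> real \<Rightarrow> (nat \<Rightarrow> gridfun) \<Rightarrow> nat \<Rightarrow> gridfun" where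
  "caputo_fwd \<alpha> dt M n i j =
     1 / caputo_scale \<alpha> dt * (M n i j - (\<Sum>k\<in>{0..<n}. c_fwd \<alpha> n k * M k i j))"

definition caputo_bwd :: "real \<Rightarrow> real \<Rightarrow> nat \<Rightarrow> (nat \<Rightarrow> gridfun) \<Rightarrow> nat \<Rightarrow> gridfun" where
  "caputo_bwd \<alpha> dt N U n i j =
     1 / caputo_scale \<alpha> dt * (U n i j - (\<Sum>k\<in>{n + 1..N}. c_bwd \<alpha> N n k * U k i j))"

definition D1_plus :: "nat \<Rightarrow> gridfun \<Rightarrow> gridfun" where
  "D1_plus Nh U i j = (U (i + 1) j - U i j) / mesh Nh"

definition D2_plus :: "nat \<Rightarrow> gridfun \<Rightarrow> gridfun" where
  "D2_plus Nh U i j = (U i (j + 1) - U i j) / mesh Nh"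

type_synonym grad4 = "real \<times> real \<times> real \<times> real"

definition discrete_grad :: "nat \<Rightarrow> gridfun \<Rightarrow> int \<Rightarrow> int \<Rightarrow> grad4" where
  "discrete_grad Nh U i j =
     (D1_plus Nh U i j, D1_plus Nh U (i - 1) j, D2_plus Nh U i j, D2_plus Nh U i (j - 1))"

definition discrete_laplacian :: "nat \<Rightarrow> gridfun \<Rightarrow> gridfun" where
  "discrete_laplacian Nh U i j =
     - (1 / (mesh Nh)\<^sup>2) * (4 * U i j - U (i + 1) j - U (i - 1) j - U i (j + 1) - U i (j - 1))"

text \<open>In the next definition this is applied jointly to the space and the gradient variables.\<close>

definition class_C1 :: "('a::euclidean_space \<Rightarrow> real) \<Rightarrow> bool" where
  "class_C1 F \<longleftrightarrow> (\<exists>F' :: 'a \<Rightarrow> 'a \<Rightarrow>\<^sub>L real.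
     (\<forall>z. (F has_derivative blinfun_apply (F' z)) (at z)) \<and> continuous_on UNIV F')"

definition numerical_hamiltonian ::
  "(point \<Rightarrow> real \<times> real \<Rightarrow> real) \<Rightarrow> (point \<Rightarrow> grad4 \<Rightarrow> real) \<Rightarrow> bool" where
  "numerical_hamiltonian H g \<longleftrightarrow>
     torus_periodic H \<and> torus_periodic g \<and>
     (\<forall>x q2 q3 q4. antimono (\<lambda>q1. g x (q1, q2, q3, q4))) \<and>
     (\<forall>x q1 q3 q4. mono (\<lambda>q2. g x (q1, q2, q3, q4))) \<and>
     (\<forall>x q1 q2 q4. antimono (\<lambda>q3. g x (q1, q2, q3, q4))) \<and>
     (\<forall>x q1 q2 q3. mono (\<lambda>q4. g x (q1, q2, q3, q4))) \<and>
     (\<forall>x q1 q2. g x (q1, q1, q2, q2) = H x (q1, q2)) \<and>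
     class_C1 (\<lambda>(x, q). g x q) \<and>
     (\<forall>x. convex_on UNIV (g x))"

definition dq1 :: "(grad4 \<Rightarrow> real) \<Rightarrow> grad4 \<Rightarrow> real" where
  "dq1 G = (\<lambda>(q1, q2, q3, q4). deriv (\<lambda>s. G (s, q2, q3, q4)) q1)"

definition dq2 :: "(grad4 \<Rightarrow> real) \<Rightarrow> grad4 \<Rightarrow> real" where
  "dq2 G = (\<lambda>(q1, q2, q3, q4). deriv (\<lambda>s. G (q1, s, q3, q4)) q2)"

definition dq3 :: "(grad4 \<Rightarrow> real) \<Rightarrow> grad4 \<Rightarrow> real" where
  "dq3 G = (\<lambda>(q1, q2, q3, q4). deriv (\<lambda>s. G (q1, q2, s, q4)) q3)"

definition dq4 :: "(grad4 \<Rightarrow> real) \<Rightarrow> grad4 \<Rightarrow> real" where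
  "dq4 G = (\<lambda>(q1, q2, q3, q4). deriv (\<lambda>s. G (q1, q2, q3, s)) q4)"

definition transport :: "(point \<Rightarrow> grad4 \<Rightarrow> real) \<Rightarrow> nat \<Rightarrow> gridfun \<Rightarrow> gridfun \<Rightarrow> gridfun" where
  "transport g Nh U M i j =
     (let g1 = (\<lambda>i j. dq1 (g (node Nh i j)) (discrete_grad Nh U i j));
          g2 = (\<lambda>i j. dq2 (g (node Nh i j)) (discrete_grad Nh U i j));
          g3 = (\<lambda>i j. dq3 (g (node Nh i j)) (discrete_grad Nh U i j));
          g4 = (\<lambda>i j. dq4 (g (node Nh i j)) (discrete_grad Nh U i j))
      in 1 / mesh Nh *
         (M i j * g1 i j - M (i - 1) j * g1 (i - 1) j
          + M (i + 1) j * g2 (i + 1) j - M i j * g2 i j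
          + M i j * g3 i j - M i (j - 1) * g3 i (j - 1)
          + M i (j + 1) * g4 i (j + 1) - M i j * g4 i j))"

definition discrete_coupling :: "((point \<Rightarrow> real) \<Rightarrow> point \<Rightarrow> real) \<Rightarrow> nat \<Rightarrow> gridfun \<Rightarrow> gridfun" where
  "discrete_coupling f Nh M i j = f (piecewise_const Nh M) (node Nh i j)"

text \<open>
  \<open>X\<close> is the class of functions on which the operator \<open>f\<close> is defined; since members of \<open>L\<^sup>1\<close>
  are functions up to null sets, \<open>f\<close> does not distinguish functions that agree almost everywhere.
  Continuity refers to the product topology on \<open>gridfun\<close>, which on \<open>Nh\<close>-periodic functions is the
  topology of the maximum norm. As the node indices in the Lipschitz bound range over all integers,
  i.e. over all representatives of the torus points, the bound is the one for the torus distance.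
  The supremum is taken in the extended reals, where it always exists.
\<close>

definition admissible_coupling ::
  "(point \<Rightarrow> real) set \<Rightarrow> ((point \<Rightarrow> real) \<Rightarrow> point \<Rightarrow> real) \<Rightarrow> bool" where
  "admissible_coupling X f \<longleftrightarrow>
     torus_densities \<subseteq> X \<and>
     (\<forall>m\<in>X. torus_periodic m \<and> torus_periodic (f m)) \<and>
     (\<forall>m\<in>X. \<forall>m'\<in>X. (AE x in lebesgue. m x = m' x) \<longrightarrow> f m = f m') \<and>
     (\<forall>Nh>0. continuous_on (grid_densities Nh) (discrete_coupling f Nh)) \<and>
     (\<forall>Nh>0. \<exists>B. \<forall>M\<in>grid_densities Nh. grid_norm_inf Nh (discrete_coupling f Nh M) \<le> B) \<and>
     (\<forall>Nh>0. \<forall>M\<in>grid_densities Nh. \<forall>M'\<in>grid_densities Nh.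
        grid_inner Nh (\<lambda>i j. discrete_coupling f Nh M i j - discrete_coupling f Nh M' i j)
          (\<lambda>i j. M i j - M' i j) \<le> 0 \<longrightarrow> M = M') \<and>
     (\<exists>C. \<forall>Nh>0. \<forall>M\<in>grid_densities Nh.
        grid_norm_inf Nh (discrete_coupling f Nh M) \<le> C \<and>
        (\<forall>i j i' j'. \<bar>discrete_coupling f Nh M i j - discrete_coupling f Nh M i' j'\<bar>
           \<le> C * norm (node Nh i j - node Nh i' j'))) \<and>
     ((\<lambda>Nh. SUP m\<in>torus_densities. ereal (grid_norm_inf Nh
          (\<lambda>i j. f m (node Nh i j) - discrete_coupling f Nh (cell_average Nh m) i j)))
        \<longlonglongrightarrow> 0)"

text \<open>
  Only the time levels \<open>0, \<dots>, N\<close> of \<open>U\<close> and \<open>M\<close> are relevant. Membership of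
  \<open>piecewise_const Nh (M (n + 1))\<close> in \<open>X\<close> says that the coupling term is defined.
\<close>

definition mfg_scheme_solution ::
  "(point \<Rightarrow> grad4 \<Rightarrow> real) \<Rightarrow> (point \<Rightarrow> real) set \<Rightarrow> ((point \<Rightarrow> real) \<Rightarrow> point \<Rightarrow> real) \<Rightarrow>
   real \<Rightarrow> real \<Rightarrow> nat \<Rightarrow> nat \<Rightarrow> (point \<Rightarrow> real) \<Rightarrow> (point \<Rightarrow> real) \<Rightarrow>
   (nat \<Rightarrow> gridfun) \<Rightarrow> (nat \<Rightarrow> gridfun) \<Rightarrow> bool" where
  "mfg_scheme_solution g X f T \<alpha> Nh N u\<^sub>T m\<^sub>0 U M \<longleftrightarrow>
     (\<forall>n\<le>N. U n \<in> grid_functions Nh \<and> M n \<in> grid_functions Nh) \<and>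
     (\<forall>n<N. piecewise_const Nh (M (n + 1)) \<in> X) \<and>
     (\<forall>n<N. \<forall>i j.
        caputo_bwd \<alpha> (T / real N) N U n i j - discrete_laplacian Nh (U n) i j
          + g (node Nh i j) (discrete_grad Nh (U n) i j)
          = discrete_coupling f Nh (M (n + 1)) i j \<and>
        caputo_fwd \<alpha> (T / real N) M (n + 1) i j - discrete_laplacian Nh (M (n + 1)) i j
          - transport g Nh (U n) (M (n + 1)) i j = 0) \<and>
     (\<forall>i j. U N i j = u\<^sub>T (node Nh i j) \<and> M 0 i j = cell_average Nh m\<^sub>0 i j)"

end

theory Submission
  imports Defs
begin

text \<open>
  The forward equation is a linear implicit scheme whose matrix has nonpositive off-diagonal entries
  and positive column sums, because the \<open>c_fwd\<close> are nonnegative and \<open>g\<close> is monotone; hence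
  \<open>M n\<close> stays nonnegative and of mass one. Given two solutions, test the difference of the backward
  equations with \<open>M - M'\<close>, subtract the difference of the forward equations tested with \<open>U - U'\<close>, and
  sum over the time levels. The discrete Caputo derivatives are adjoint to each other, so they
  cancel, as do the Laplacians, and convexity of \<open>g\<close> gives the Hamiltonian terms a sign. What is left
  is that the sum of the coupling terms is nonpositive; strict monotonicity of the coupling forces
  \<open>M = M'\<close>. Then \<open>U = U'\<close> by the discrete maximum principle, backward in time.
\<close>

subsection \<open>Cell averages of periodic densities\<close>

lemma negligible_vertical_line: "negligible {x :: point. fst x = b}"
proof -
  have "{x :: point. fst x = b} = {x. (1, 0) \<bullet> x = b}" by auto
  moreover have "negligible {x :: point. (1, 0) \<bullet> x = b}"
    by (rule negligible_hyperplane) (auto simp: zero_prod_def)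
  ultimately show ?thesis by metis
qed

lemma negligible_horizontal_line: "negligible {x :: point. snd x = b}"
proof -
  have "{x :: point. snd x = b} = {x. (0, 1) \<bullet> x = b}" by auto
  moreover have "negligible {x :: point. (0, 1) \<bullet> x = b}"
    by (rule negligible_hyperplane) (auto simp: zero_prod_def)
  ultimately show ?thesis by metis
qed

lemma has_integral_combine_fst:
  fixes F :: "point \<Rightarrow> real"
  assumes "a \<le> b" "b \<le> e"
    and "(F has_integral I) (cbox (a, c) (b, d))" "(F has_integral J) (cbox (b, c) (e, d))"
  shows "(F has_integral I + J) (cbox (a, c) (e, d))"
proof -
  have "negligible (cbox (a, c) (b, d) \<inter> cbox (b, c) (e, d))"
    by (rule negligible_subset[OF negligible_vertical_line[of b]]) auto
  from has_integral_Un[OF assms(3,4) this]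
  have "(F has_integral I + J) (cbox (a, c) (b, d) \<union> cbox (b, c) (e, d))" .
  moreover have "cbox (a, c) (b, d) \<union> cbox (b, c) (e, d) = cbox (a, c) (e, d)"
    using assms(1,2) by auto
  ultimately show ?thesis by metis
qed

lemma has_integral_combine_snd:
  fixes F :: "point \<Rightarrow> real"
  assumes "c \<le> d" "d \<le> e"
    and "(F has_integral I) (cbox (a, c) (b, d))" "(F has_integral J) (cbox (a, d) (b, e))"
  shows "(F has_integral I + J) (cbox (a, c) (b, e))"
proof -
  have "negligible (cbox (a, c) (b, d) \<inter> cbox (a, d) (b, e))"
    by (rule negligible_subset[OF negligible_horizontal_line[of d]]) auto
  from has_integral_Un[OF assms(3,4) this]
  have "(F has_integral I + J) (cbox (a, c) (b, d) \<union> cbox (a, d) (b, e))" .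
  moreover have "cbox (a, c) (b, d) \<union> cbox (a, d) (b, e) = cbox (a, c) (b, e)"
    using assms(1,2) by auto
  ultimately show ?thesis by metis
qed

lemma torus_periodic_has_integral_shift_fst:
  assumes "torus_periodic F"
  shows "(F has_integral I) (cbox (a + 1, c) (b + 1, d)) \<longleftrightarrow> (F has_integral (I::real)) (cbox (a, c) (b, d))"
proof -
  have "F \<circ> (+) (1, 0) = F"
    using assms unfolding torus_periodic_def by (auto simp: fun_eq_iff add.commute)
  then show ?thesis
    using has_integral_shift_cbox_iff[of F "(1, 0)" I "(a, c)" "(b, d)"] by simp
qed

lemma torus_periodic_has_integral_shift_snd:
  assumes "torus_periodic F"
  shows "(F has_integral I) (cbox (a, c + 1) (b, d + 1)) \<longleftrightarrow> (F has_integral (I::real)) (cbox (a, c) (b, d))"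
proof -
  have "F \<circ> (+) (0, 1) = F"
    using assms unfolding torus_periodic_def by (auto simp: fun_eq_iff add.commute)
  then show ?thesis
    using has_integral_shift_cbox_iff[of F "(0, 1)" I "(a, c)" "(b, d)"] by simp
qed

text \<open>Cut the unit square at the abscissa \<open>1 + s\<close> and move the right strip one
  period to the left; then do the same vertically. This is needed because cells are centred at
  nodes, so that a full period of cells covers the square displaced by half a mesh width.\<close>

lemma torus_periodic_has_integral_unit_square:
  fixes F :: "point \<Rightarrow> real"
  assumes per: "torus_periodic F" and int: "(F has_integral I) (cbox (0, 0) (1, 1))"
    and s: "-1 \<le> s" "s \<le> 0" and t: "-1 \<le> t" "t \<le> 0"
  shows "(F has_integral I) (cbox (s, t) (1 + s, 1 + t))"
proof -
  have intF: "F integrable_on cbox (0, 0) (1, 1)"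
    using int by blast
  have sub: "F integrable_on cbox (a, c) (b, d)"
    if "cbox (a, c) (b, d) \<subseteq> cbox (0, 0) (1, 1)" for a b c d
    by (rule integrable_on_subcbox[OF intF that])
  \<comment> \<open>The bounds \<open>s + 1\<close> and \<open>0 + 1\<close> have the shape in which
    a strip can be moved back by one period.\<close>
  obtain I1 I2 where
    I1: "(F has_integral I1) (cbox (0, 0) (1 + s, 1))" and
    I2: "(F has_integral I2) (cbox (s + 1, 0) (0 + 1, 1))"
    using sub[of 0 0 "1 + s" 1] sub[of "s + 1" 0 "0 + 1" 1] s
    unfolding integrable_on_def by force
  have "(F has_integral I1 + I2) (cbox (0, 0) (1, 1))"
    using has_integral_combine_fst[of 0 "1 + s" 1 F I1 0 1 I2] I1 I2 s by (simp add: add.commute)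
  then have I: "I = I1 + I2"
    using int has_integral_unique by blast
  have "(F has_integral I2) (cbox (s, 0) (0, 1))"
    using I2 torus_periodic_has_integral_shift_fst[OF per, of I2 s 0 0 1] by blast
  then have strip: "(F has_integral I) (cbox (s, 0) (1 + s, 1))"
    using has_integral_combine_fst[of s 0 "1 + s" F I2 0 1 I1] I1 s I by (simp add: add.commute)
  then have intS: "F integrable_on cbox (s, 0) (1 + s, 1)"
    by blast
  have subS: "F integrable_on cbox (a, c) (b, d)"
    if "cbox (a, c) (b, d) \<subseteq> cbox (s, 0) (1 + s, 1)" for a b c d
    by (rule integrable_on_subcbox[OF intS that])
  obtain J1 J2 where
    J1: "(F has_integral J1) (cbox (s, 0) (1 + s, 1 + t))" and
    J2: "(F has_integral J2) (cbox (s, t + 1) (1 + s, 0 + 1))"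
    using subS[of s 0 "1 + s" "1 + t"] subS[of s "t + 1" "1 + s" "0 + 1"] t
    unfolding integrable_on_def by force
  have "(F has_integral J1 + J2) (cbox (s, 0) (1 + s, 1))"
    using has_integral_combine_snd[of 0 "1 + t" 1 F J1 s "1 + s" J2] J1 J2 t by (simp add: add.commute)
  then have J: "I = J1 + J2"
    using strip has_integral_unique by blast
  have "(F has_integral J2) (cbox (s, t) (1 + s, 0))"
    using J2 torus_periodic_has_integral_shift_snd[OF per, of J2 s t "1 + s" 0] by blast
  then show ?thesis
    using has_integral_combine_snd[of t 0 "1 + t" F J2 s "1 + s" J1] J1 t J by (simp add: add.commute)
qed

lemma has_integral_grid_strips_fst:
  fixes F :: "point \<Rightarrow> real"
  assumes "0 \<le> h" "\<And>i. i < k \<Longrightarrow> (F has_integral I i) (cbox (a + real i * h, c) (a + real (Suc i) * h, d))"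
  shows "(F has_integral (\<Sum>i<k. I i)) (cbox (a, c) (a + real k * h, d))"
  using assms(2)
proof (induction k)
  case 0
  have "negligible (cbox (a, c) (a, d))"
    by (rule negligible_subset[OF negligible_vertical_line[of a]]) auto
  then have "(F has_integral 0) (cbox (a, c) (a, d))"
    by (rule has_integral_negligible) auto
  then show ?case by simp
next
  case (Suc k)
  then have "(F has_integral (\<Sum>i<k. I i)) (cbox (a, c) (a + real k * h, d))" by simp
  from has_integral_combine_fst[OF _ _ this Suc.prems[of k]] \<open>0 \<le> h\<close>
  show ?case by (simp add: algebra_simps)
qed

lemma has_integral_grid_strips_snd:
  fixes F :: "point \<Rightarrow> real"
  assumes "0 \<le> h" "\<And>i. i < k \<Longrightarrow> (F has_integral I i) (cbox (a, c + real i * h) (b, c + real (Suc i) * h))"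
  shows "(F has_integral (\<Sum>i<k. I i)) (cbox (a, c) (b, c + real k * h))"
  using assms(2)
proof (induction k)
  case 0
  have "negligible (cbox (a, c) (b, c))"
    by (rule negligible_subset[OF negligible_horizontal_line[of c]]) auto
  then have "(F has_integral 0) (cbox (a, c) (b, c))"
    by (rule has_integral_negligible) auto
  then show ?case by simp
next
  case (Suc k)
  then have "(F has_integral (\<Sum>i<k. I i)) (cbox (a, c) (b, c + real k * h))" by simp
  from has_integral_combine_snd[OF _ _ this Suc.prems[of k]] \<open>0 \<le> h\<close>
  show ?case by (simp add: algebra_simps)
qed

lemma infnorm_Pair: "infnorm (x :: point) = max \<bar>fst x\<bar> \<bar>snd x\<bar>"
proof -
  have "(\<lambda>b. \<bar>x \<bullet> b\<bar>) ` Basis = {\<bar>fst x\<bar>, \<bar>snd x\<bar>}"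
    by (auto simp: Basis_prod_def inner_prod_def)
  then show ?thesis by (simp add: infnorm_Max)
qed

lemma cell_eq_cbox:
  "cell Nh i j = cbox ((of_int i - 1/2) * mesh Nh, (of_int j - 1/2) * mesh Nh)
     ((of_int i + 1/2) * mesh Nh, (of_int j + 1/2) * mesh Nh)"
proof (rule set_eqI)
  fix x :: point
  have *: "\<bar>u - of_int k * mesh Nh\<bar> \<le> mesh Nh / 2
      \<longleftrightarrow> (of_int k - 1/2) * mesh Nh \<le> u \<and> u \<le> (of_int k + 1/2) * mesh Nh" for u and k :: int
    by (simp only: abs_le_iff left_diff_distrib distrib_right) linarith
  show "x \<in> cell Nh i j \<longleftrightarrow> x \<in> cbox ((of_int i - 1/2) * mesh Nh, (of_int j - 1/2) * mesh Nh)
     ((of_int i + 1/2) * mesh Nh, (of_int j + 1/2) * mesh Nh)"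
    unfolding cell_def node_def infnorm_Pair using *[of "fst x" i] *[of "snd x" j] by (cases x) auto
qed

lemma mesh_pos: "Nh > 0 \<Longrightarrow> mesh Nh > 0"
  by (simp add: mesh_def)

lemma cbox_Pair_mono:
  fixes a b c d :: real
  assumes "a' \<le> a" "c' \<le> c" "b \<le> b'" "d \<le> d'"
  shows "cbox (a, c) (b, d) \<subseteq> cbox (a', c') (b', d')"
  using assms by auto

text \<open>The cells of one period tile the unit square displaced by \<open>-h/2\<close> in both
  directions. By periodicity this square carries the same mass one, and the averages are cell masses
  divided by the cell area.\<close>

lemma sum_cell_average:
  assumes Nh: "Nh > 0" and m: "m \<in> torus_densities"
  shows "(\<Sum>i\<in>{0..<int Nh}. \<Sum>j\<in>{0..<int Nh}. cell_average Nh m i j) = 1 / (mesh Nh)\<^sup>2"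
proof -
  define h where "h = mesh Nh"
  have h: "h > 0" "real Nh * h = 1" "h \<le> 1"
    using Nh by (auto simp: h_def mesh_def field_simps)
  have per: "torus_periodic m" and absm: "set_integrable lebesgue (cbox (0, 0) (1, 1)) m"
    and mass: "(LINT x:cbox (0, 0) (1, 1)|lebesgue. m x) = 1"
    using m by (auto simp: torus_densities_def)
  have int1: "(m has_integral 1) (cbox (0, 0) (1, 1))"
    using has_integral_set_lebesgue[OF absm] mass by simp
  \<comment> \<open>Displacing the square is justified for the gauge integral only. Displacing the
    integral of the norm as well recovers absolute integrability, hence the Lebesgue integrals over
    the cells.\<close>
  obtain K where K: "((\<lambda>x. norm (m x)) has_integral K) (cbox (0, 0) (1, 1))"
    using absm unfolding absolutely_integrable_on_def by blast
  have per': "torus_periodic (\<lambda>x. norm (m x))"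
    using per by (simp add: torus_periodic_def)
  let ?Q = "cbox (-h/2, -h/2) (1 - h/2, 1 - h/2)"
  have Q: "(m has_integral 1) ?Q" "((\<lambda>x. norm (m x)) has_integral K) ?Q"
    using torus_periodic_has_integral_unit_square[OF per int1, of "-h/2" "-h/2"]
      torus_periodic_has_integral_unit_square[OF per' K, of "-h/2" "-h/2"] h by auto
  then have absQ: "m absolutely_integrable_on ?Q"
    unfolding absolutely_integrable_on_def by blast
  let ?C = "\<lambda>i j. cbox (-h/2 + real i * h, -h/2 + real j * h)
     (-h/2 + real (Suc i) * h, -h/2 + real (Suc j) * h)"
  have C: "cell Nh (int i) (int j) = ?C i j" for i j
    by (simp add: cell_eq_cbox h_def algebra_simps)
  have le: "real (Suc i) * h \<le> 1" if "i < Nh" for i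
    using that h mult_right_mono[of "real (Suc i)" "real Nh" h] by simp
  have pos: "0 \<le> real i * h" for i
    using h by simp
  have CQ: "?C i j \<subseteq> ?Q" if "i < Nh" "j < Nh" for i j
  proof (rule cbox_Pair_mono)
    show "- h / 2 \<le> - h / 2 + real i * h" "- h / 2 \<le> - h / 2 + real j * h"
      using pos[of i] pos[of j] by linarith+
    show "- h / 2 + real (Suc i) * h \<le> 1 - h / 2" "- h / 2 + real (Suc j) * h \<le> 1 - h / 2"
      using le[OF that(1)] le[OF that(2)] by linarith+
  qed
  define A where "A i j = (LINT x:cell Nh (int i) (int j)|lebesgue. m x)" for i j
  have hasA: "(m has_integral A i j) (?C i j)" if "i < Nh" "j < Nh" for i j
    unfolding A_def C
    by (rule has_integral_set_lebesgue, rule set_integrable_subset[OF absQ _ CQ[OF that]]) auto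
  have "(m has_integral (\<Sum>j<Nh. A i j))
     (cbox (-h/2 + real i * h, -h/2) (-h/2 + real (Suc i) * h, -h/2 + real Nh * h))"
    if "i < Nh" for i
    using h that by (intro has_integral_grid_strips_snd hasA) simp_all
  from has_integral_grid_strips_fst[OF _ this]
  have "(m has_integral (\<Sum>i<Nh. \<Sum>j<Nh. A i j))
     (cbox (-h/2, -h/2) (-h/2 + real Nh * h, -h/2 + real Nh * h))"
    using h(1) by simp
  then have "(m has_integral (\<Sum>i<Nh. \<Sum>j<Nh. A i j)) ?Q"
    unfolding h(2) by simp
  then have sumA: "(\<Sum>i<Nh. \<Sum>j<Nh. A i j) = 1"
    using Q(1) by (rule has_integral_unique)
  have reindex: "(\<Sum>i\<in>{0..<int Nh}. G i) = (\<Sum>i<Nh. G (int i))" for G :: "int \<Rightarrow> real"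
    using sum.reindex[of int "{0..<Nh}" G] image_int_atLeastLessThan[of 0 Nh]
    by (simp add: lessThan_atLeast0 o_def)
  have "(\<Sum>i\<in>{0..<int Nh}. \<Sum>j\<in>{0..<int Nh}. cell_average Nh m i j)
      = (\<Sum>i<Nh. \<Sum>j<Nh. 1 / h\<^sup>2 * A i j)"
    by (simp add: reindex cell_average_def A_def h_def)
  also have "\<dots> = 1 / h\<^sup>2"
    unfolding sum_distrib_left[symmetric] sumA by simp
  finally show ?thesis by (simp add: h_def)
qed

lemma cell_average_nonneg:
  assumes "m \<in> torus_densities"
  shows "0 \<le> cell_average Nh m i j"
proof -
  have "AE x in lebesgue. 0 \<le> m x"
    using assms by (simp add: torus_densities_def)
  then have "0 \<le> (LINT x:cell Nh i j|lebesgue. m x)"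
    unfolding set_lebesgue_integral_def by (intro integral_nonneg_AE) (auto elim!: eventually_mono)
  then show ?thesis by (simp add: cell_average_def)
qed

lemma cell_average_in_grid_densities:
  assumes "Nh > 0" "m \<in> torus_densities" "M \<in> grid_functions Nh" "M = cell_average Nh m"
  shows "M \<in> grid_densities Nh"
  using assms sum_cell_average[OF assms(1,2)] cell_average_nonneg[OF assms(2)] mesh_pos[OF assms(1)]
  by (simp add: grid_densities_def grid_inner_def)

subsection \<open>Summation by parts on the grid\<close>

text \<open>Reduction modulo \<open>n\<close> subtracts the multiple \<open>i div n\<close> of the
  period. A negative multiple is handled by starting from the other end.\<close>

lemma periodic_int_mod:
  fixes F :: "int \<Rightarrow> 'a"
  assumes per: "\<And>i. F (i + n) = F i"
  shows "F (i mod n) = F i"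
proof -
  have nat: "F (i + int k * n) = F i" for i k
  proof (induction k)
    case (Suc k)
    then show ?case using per[of "i + int k * n"] by (simp add: algebra_simps)
  qed simp
  have "F (i + k * n) = F i" for i k
  proof (cases "k \<ge> 0")
    case True
    then show ?thesis using nat[of i "nat k"] by simp
  next
    case False
    then show ?thesis using nat[of "i + k * n" "nat (- k)"] by simp
  qed
  from this[of i "- (i div n)"] show ?thesis
    by (simp add: minus_mult_div_eq_mod[symmetric] algebra_simps)
qed

text \<open>The shifted range loses the index 0 and gains the index \<open>n\<close>, where the
  function has the same value.\<close>

lemma sum_periodic_shift:
  fixes F :: "int \<Rightarrow> real"
  assumes per: "\<And>i. F (i + int n) = F i"
  shows "(\<Sum>i\<in>{0..<int n}. F (i + 1)) = (\<Sum>i\<in>{0..<int n}. F i)"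
proof (cases "n = 0")
  case False
  have "(\<Sum>i\<in>{0..<int n}. F (i + 1)) = (\<Sum>i\<in>{1..<int n + 1}. F i)"
    by (rule sum.reindex_bij_witness[of _ "\<lambda>i. i - 1" "\<lambda>i. i + 1"]) auto
  also have "{1..<int n + 1} = insert (int n) {1..<int n}"
    using False by auto
  also have "(\<Sum>i\<in>insert (int n) {1..<int n}. F i) = F 0 + (\<Sum>i\<in>{1..<int n}. F i)"
    using per[of 0] by simp
  also have "\<dots> = (\<Sum>i\<in>insert 0 {1..<int n}. F i)"
    by simp
  also have "insert 0 {1..<int n} = {0..<int n}"
    using False by auto
  finally show ?thesis .
qed simp

lemma grid_functions_mod:
  assumes "U \<in> grid_functions Nh"
  shows "U (i mod int Nh) (j mod int Nh) = U i j"
  using periodic_int_mod[of "\<lambda>i. U i (j mod int Nh)" "int Nh"] periodic_int_mod[of "U i" "int Nh"] assms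
  by (simp add: grid_functions_def)

lemma grid_functions_map2:
  assumes "U \<in> grid_functions Nh" "V \<in> grid_functions Nh"
  shows "(\<lambda>i j. F (U i j) (V i j)) \<in> grid_functions Nh"
  using assms by (simp add: grid_functions_def)

lemmas grid_functions_mult = grid_functions_map2[where F = "(*)"]
lemmas grid_functions_diff = grid_functions_map2[where F = "(-)"]

lemma grid_functions_translate:
  assumes "U \<in> grid_functions Nh"
  shows "(\<lambda>i j. U (i + a) (j + b)) \<in> grid_functions Nh"
proof -
  have "U (i + int Nh + a) (j + b) = U (i + a) (j + b)" "U (i + a) (j + int Nh + b) = U (i + a) (j + b)" for i j
    using assms[unfolded grid_functions_def, simplified, rule_format, of "i + a" "j + b"]
    by (simp_all add: algebra_simps)
  then show ?thesis by (simp add: grid_functions_def)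
qed

text \<open>The weight h^2 of the inner product is left out, since it would be a common factor
  throughout.\<close>

definition grid_sum :: "nat \<Rightarrow> gridfun \<Rightarrow> real" where
  "grid_sum Nh F = (\<Sum>i\<in>{0..<int Nh}. \<Sum>j\<in>{0..<int Nh}. F i j)"

lemma grid_inner_eq_grid_sum: "grid_inner Nh U V = (mesh Nh)\<^sup>2 * grid_sum Nh (\<lambda>i j. U i j * V i j)"
  by (simp add: grid_inner_def grid_sum_def)

lemma grid_sum_add: "grid_sum Nh (\<lambda>i j. F i j + G i j) = grid_sum Nh F + grid_sum Nh G"
  by (simp add: grid_sum_def sum.distrib)

lemma grid_sum_diff: "grid_sum Nh (\<lambda>i j. F i j - G i j) = grid_sum Nh F - grid_sum Nh G"
  by (simp add: grid_sum_def sum_subtractf)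

lemma grid_sum_minus: "grid_sum Nh (\<lambda>i j. - F i j) = - grid_sum Nh F"
  by (simp add: grid_sum_def sum_negf)

lemma grid_sum_cmult: "grid_sum Nh (\<lambda>i j. c * F i j) = c * grid_sum Nh F"
  by (simp add: grid_sum_def sum_distrib_left)

lemma grid_sum_sum: "grid_sum Nh (\<lambda>i j. \<Sum>k\<in>K. F k i j) = (\<Sum>k\<in>K. grid_sum Nh (F k))"
  by (simp add: grid_sum_def sum.swap[of _ _ K])

lemma grid_sum_nonneg: "(\<And>i j. 0 \<le> F i j) \<Longrightarrow> 0 \<le> grid_sum Nh F"
  by (simp add: grid_sum_def sum_nonneg)

lemma grid_sum_nonpos: "(\<And>i j. F i j \<le> 0) \<Longrightarrow> grid_sum Nh F \<le> 0"
  by (simp add: grid_sum_def sum_nonpos)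

text \<open>The summands vanish on one period, and periodicity spreads this to all integer
  indices.\<close>

lemma grid_sum_nonneg_eq_0D:
  assumes "F \<in> grid_functions Nh" "Nh > 0" "\<And>i j. 0 \<le> F i j" "grid_sum Nh F = 0"
  shows "F i j = 0"
proof -
  have "\<forall>i\<in>{0..<int Nh}. (\<Sum>j\<in>{0..<int Nh}. F i j) = 0"
    using assms(3,4) unfolding grid_sum_def
    by (subst (asm) sum_nonneg_eq_0_iff) (auto intro!: sum_nonneg)
  then have "\<forall>i\<in>{0..<int Nh}. \<forall>j\<in>{0..<int Nh}. F i j = 0"
    using assms(3) by (auto simp: sum_nonneg_eq_0_iff)
  then have "F (i mod int Nh) (j mod int Nh) = 0"
    using assms(2) by simp
  then show ?thesis using grid_functions_mod[OF assms(1)] by simp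
qed

lemma grid_sum_shift_fst:
  assumes "F \<in> grid_functions Nh"
  shows "grid_sum Nh (\<lambda>i j. F (i + 1) j) = grid_sum Nh F"
  unfolding grid_sum_def
  by (rule sum_periodic_shift[of "\<lambda>i. \<Sum>j\<in>{0..<int Nh}. F i j"]) (use assms in \<open>simp add: grid_functions_def\<close>)

lemma grid_sum_shift_snd:
  assumes "F \<in> grid_functions Nh"
  shows "grid_sum Nh (\<lambda>i j. F i (j + 1)) = grid_sum Nh F"
  unfolding grid_sum_def
  by (rule sum.cong[OF refl], rule sum_periodic_shift) (use assms in \<open>simp add: grid_functions_def\<close>)

text \<open>Summation by parts: the adjoint of a shift is the opposite shift, because the sum of a
  periodic product does not change under translation.\<close>

lemma grid_sum_parts_fst:
  assumes "A \<in> grid_functions Nh" "W \<in> grid_functions Nh"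
  shows "grid_sum Nh (\<lambda>i j. A (i - 1) j * W i j) = grid_sum Nh (\<lambda>i j. A i j * W (i + 1) j)"
  using grid_sum_shift_fst[of "\<lambda>i j. A (i - 1) j * W i j" Nh]
    grid_functions_mult[OF grid_functions_translate[OF assms(1), of "-1" 0] assms(2)]
  by simp

lemma grid_sum_parts_snd:
  assumes "A \<in> grid_functions Nh" "W \<in> grid_functions Nh"
  shows "grid_sum Nh (\<lambda>i j. A i (j - 1) * W i j) = grid_sum Nh (\<lambda>i j. A i j * W i (j + 1))"
  using grid_sum_shift_snd[of "\<lambda>i j. A i (j - 1) * W i j" Nh]
    grid_functions_mult[OF grid_functions_translate[OF assms(1), of 0 "-1"] assms(2)]
  by simp

lemma grid_sum_parts_fst':
  assumes "A \<in> grid_functions Nh" "W \<in> grid_functions Nh"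
  shows "grid_sum Nh (\<lambda>i j. A (i + 1) j * W i j) = grid_sum Nh (\<lambda>i j. A i j * W (i - 1) j)"
  using grid_sum_parts_fst[OF assms(2,1)] by (simp add: mult.commute)

lemma grid_sum_parts_snd':
  assumes "A \<in> grid_functions Nh" "W \<in> grid_functions Nh"
  shows "grid_sum Nh (\<lambda>i j. A i (j + 1) * W i j) = grid_sum Nh (\<lambda>i j. A i j * W i (j - 1))"
  using grid_sum_parts_snd[OF assms(2,1)] by (simp add: mult.commute)

text \<open>Moving the four neighbour shifts to the other factor exchanges left with right and down
  with up, which leaves the five-point stencil unchanged.\<close>

lemma grid_sum_laplacian_sym:
  assumes "M \<in> grid_functions Nh" "W \<in> grid_functions Nh"
  shows "grid_sum Nh (\<lambda>i j. discrete_laplacian Nh M i j * W i j)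
    = grid_sum Nh (\<lambda>i j. M i j * discrete_laplacian Nh W i j)"
proof -
  let ?c = "- (1 / (mesh Nh)\<^sup>2)"
  have "grid_sum Nh (\<lambda>i j. discrete_laplacian Nh M i j * W i j)
     = ?c * grid_sum Nh (\<lambda>i j. 4 * (M i j * W i j) - M (i + 1) j * W i j - M (i - 1) j * W i j
         - M i (j + 1) * W i j - M i (j - 1) * W i j)"
    unfolding discrete_laplacian_def by (subst grid_sum_cmult[symmetric]) (simp add: algebra_simps)
  also have "\<dots> = ?c * grid_sum Nh (\<lambda>i j. 4 * (M i j * W i j) - M i j * W (i - 1) j - M i j * W (i + 1) j
         - M i j * W i (j - 1) - M i j * W i (j + 1))"
    by (simp only: grid_sum_diff grid_sum_parts_fst[OF assms] grid_sum_parts_snd[OF assms]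
        grid_sum_parts_fst'[OF assms] grid_sum_parts_snd'[OF assms])
  also have "\<dots> = grid_sum Nh (\<lambda>i j. M i j * discrete_laplacian Nh W i j)"
    unfolding discrete_laplacian_def by (subst grid_sum_cmult[symmetric]) (simp add: algebra_simps)
  finally show ?thesis .
qed

subsection \<open>Derivative of the numerical Hamiltonian\<close>

text \<open>For differentiable \<open>G\<close> this is the differential at \<open>q\<close>,
  applied to a direction.\<close>

definition grad_pairing :: "(grad4 \<Rightarrow> real) \<Rightarrow> grad4 \<Rightarrow> grad4 \<Rightarrow> real" where
  "grad_pairing G q = (\<lambda>(p1, p2, p3, p4). dq1 G q * p1 + dq2 G q * p2 + dq3 G q * p3 + dq4 G q * p4)"

lemma discrete_grad_diff:
  "discrete_grad Nh (\<lambda>i j. U i j - V i j) i j = discrete_grad Nh U i j - discrete_grad Nh V i j"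
  by (simp add: discrete_grad_def D1_plus_def D2_plus_def diff_divide_distrib)

lemma discrete_laplacian_diff:
  "discrete_laplacian Nh (\<lambda>i j. U i j - V i j) i j
    = discrete_laplacian Nh U i j - discrete_laplacian Nh V i j"
  by (simp add: discrete_laplacian_def algebra_simps)

lemma grad_pairing_minus: "grad_pairing G q (- p) = - grad_pairing G q p"
  by (cases p) (simp add: grad_pairing_def)

lemma periodic_Hamiltonian_on_nodes:
  assumes "torus_periodic g" "Nh > 0"
  shows "g (node Nh (i + int Nh) j) = g (node Nh i j)" "g (node Nh i (j + int Nh)) = g (node Nh i j)"
proof -
  have "node Nh (i + int Nh) j = node Nh i j + (1, 0)" "node Nh i (j + int Nh) = node Nh i j + (0, 1)"
    using assms(2) by (auto simp: node_def mesh_def field_simps)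
  then show "g (node Nh (i + int Nh) j) = g (node Nh i j)" "g (node Nh i (j + int Nh)) = g (node Nh i j)"
    using assms(1) unfolding torus_periodic_def by metis+
qed

lemma discrete_grad_periodic:
  assumes "U \<in> grid_functions Nh"
  shows "discrete_grad Nh U (i + int Nh) j = discrete_grad Nh U i j"
    "discrete_grad Nh U i (j + int Nh) = discrete_grad Nh U i j"
proof -
  have *: "U (i + int Nh + a) (j + b) = U (i + a) (j + b)" "U (i + a) (j + int Nh + b) = U (i + a) (j + b)" for a b
    using grid_functions_translate[OF assms, of a b] by (simp_all add: grid_functions_def)
  show "discrete_grad Nh U (i + int Nh) j = discrete_grad Nh U i j"
    "discrete_grad Nh U i (j + int Nh) = discrete_grad Nh U i j"
    using *[of 0 0] *[of 1 0] *[of "-1" 0] *[of 0 1] *[of 0 "-1"] *[of "-1" 1] *[of 1 "-1"]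
    by (simp_all add: discrete_grad_def D1_plus_def D2_plus_def)
qed

text \<open>The transport operator is minus the adjoint of the linearised Hamiltonian: once the
  shifts sit on \<open>W\<close>, the four pairs of terms become the four one-sided differences of
  \<open>W\<close>.\<close>

lemma grid_sum_transport_parts:
  assumes "torus_periodic g" "Nh > 0"
    and U: "U \<in> grid_functions Nh" and M: "M \<in> grid_functions Nh" and W: "W \<in> grid_functions Nh"
  shows "grid_sum Nh (\<lambda>i j. transport g Nh U M i j * W i j)
    = - grid_sum Nh (\<lambda>i j. M i j * grad_pairing (g (node Nh i j)) (discrete_grad Nh U i j) (discrete_grad Nh W i j))"
proof -
  \<comment> \<open>The argument \<open>d\<close> selects the partial derivative, so that one
    periodicity proof serves all four products.\<close>
  define A where "A d i j = M i j * d (g (node Nh i j)) (discrete_grad Nh U i j)"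
    for d :: "(grad4 \<Rightarrow> real) \<Rightarrow> grad4 \<Rightarrow> real" and i j
  have A: "A d \<in> grid_functions Nh" for d
    using M by (simp add: A_def grid_functions_def periodic_Hamiltonian_on_nodes[OF assms(1,2)]
        discrete_grad_periodic[OF U])
  have "grid_sum Nh (\<lambda>i j. transport g Nh U M i j * W i j)
    = 1 / mesh Nh * grid_sum Nh (\<lambda>i j. A dq1 i j * W i j - A dq1 (i - 1) j * W i j
        + A dq2 (i + 1) j * W i j - A dq2 i j * W i j + A dq3 i j * W i j - A dq3 i (j - 1) * W i j
        + A dq4 i (j + 1) * W i j - A dq4 i j * W i j)"
    unfolding transport_def Let_def A_def by (subst grid_sum_cmult[symmetric]) (simp add: algebra_simps)
  also have "\<dots> = 1 / mesh Nh * grid_sum Nh (\<lambda>i j. A dq1 i j * W i j - A dq1 i j * W (i + 1) j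
        + A dq2 i j * W (i - 1) j - A dq2 i j * W i j + A dq3 i j * W i j - A dq3 i j * W i (j + 1)
        + A dq4 i j * W i (j - 1) - A dq4 i j * W i j)"
    by (simp only: grid_sum_diff grid_sum_add grid_sum_parts_fst[OF A W] grid_sum_parts_snd[OF A W]
        grid_sum_parts_fst'[OF A W] grid_sum_parts_snd'[OF A W])
  also have "\<dots> = - grid_sum Nh (\<lambda>i j. M i j *
      grad_pairing (g (node Nh i j)) (discrete_grad Nh U i j) (discrete_grad Nh W i j))"
    unfolding grid_sum_cmult[symmetric] grid_sum_minus[symmetric]
    by (simp add: A_def grad_pairing_def discrete_grad_def D1_plus_def D2_plus_def algebra_simps
        diff_divide_distrib add_divide_distrib)
  finally show ?thesis .
qed

text \<open>The partial derivatives in the scheme are defined by \<open>deriv\<close> in one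
  variable. The joint C1 assumption yields a total derivative; restricting it to the coordinate
  lines identifies its values on the basis vectors, and linearity does the rest.\<close>

lemma grad_pairing_has_derivative:
  assumes "numerical_hamiltonian H g"
  shows "(g x has_derivative grad_pairing (g x) q) (at q)"
proof -
  have "class_C1 (\<lambda>(x, q). g x q)"
    using assms by (simp add: numerical_hamiltonian_def)
  then obtain F' :: "point \<times> grad4 \<Rightarrow> (point \<times> grad4) \<Rightarrow>\<^sub>L real"
    where F': "((\<lambda>(x, q). g x q) has_derivative blinfun_apply (F' z)) (at z)" for z
    unfolding class_C1_def by blast
  \<comment> \<open>With \<open>x\<close> frozen, only directions without a space component
    remain.\<close>
  define D where "D p = F' (x, q) (0, p)" for p
  have "((\<lambda>q. (x, q)) has_derivative (\<lambda>p. (0, p))) (at q)"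
    by (auto intro!: derivative_eq_intros)
  from diff_chain_at[OF this F'[of "(x, q)"]] have D: "(g x has_derivative D) (at q)"
    by (simp add: o_def D_def[abs_def])
  then interpret D: linear D
    using has_derivative_linear by blast
  obtain q1 q2 q3 q4 where q: "q = (q1, q2, q3, q4)"
    by (cases q) auto
  \<comment> \<open>Chain rule along the first coordinate line; the other three coordinates are
    treated alike.\<close>
  have 1: "((\<lambda>s. g x (s, q2, q3, q4)) has_real_derivative D (1, 0, 0, 0)) (at q1)"
  proof -
    have lin: "(\<lambda>s. D (s, 0, 0, 0)) = (*) (D (1, 0, 0, 0))"
    proof
      fix s show "D (s, 0, 0, 0) = D (1, 0, 0, 0) * s"
        using D.scale[of s "(1, 0, 0, 0)"] by (simp only: scaleR_Pair real_scaleR_def mult_zero_left mult_1_left mult.commute)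
    qed
    have "((\<lambda>s. (s, q2, q3, q4)) has_derivative (\<lambda>s. (s, 0, 0, 0))) (at q1)"
      by (auto intro!: derivative_eq_intros simp: zero_prod_def)
    from diff_chain_at[OF this D[unfolded q]] show ?thesis
      by (simp add: o_def has_field_derivative_def lin)
  qed
  have 2: "((\<lambda>s. g x (q1, s, q3, q4)) has_real_derivative D (0, 1, 0, 0)) (at q2)"
  proof -
    have lin: "(\<lambda>s. D (0, s, 0, 0)) = (*) (D (0, 1, 0, 0))"
    proof
      fix s show "D (0, s, 0, 0) = D (0, 1, 0, 0) * s"
        using D.scale[of s "(0, 1, 0, 0)"] by (simp only: scaleR_Pair real_scaleR_def mult_zero_left mult_1_left mult.commute)
    qed
    have "((\<lambda>s. (q1, s, q3, q4)) has_derivative (\<lambda>s. (0, s, 0, 0))) (at q2)"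
      by (auto intro!: derivative_eq_intros simp: zero_prod_def)
    from diff_chain_at[OF this D[unfolded q]] show ?thesis
      by (simp add: o_def has_field_derivative_def lin)
  qed
  have 3: "((\<lambda>s. g x (q1, q2, s, q4)) has_real_derivative D (0, 0, 1, 0)) (at q3)"
  proof -
    have lin: "(\<lambda>s. D (0, 0, s, 0)) = (*) (D (0, 0, 1, 0))"
    proof
      fix s show "D (0, 0, s, 0) = D (0, 0, 1, 0) * s"
        using D.scale[of s "(0, 0, 1, 0)"] by (simp only: scaleR_Pair real_scaleR_def mult_zero_left mult_1_left mult.commute)
    qed
    have "((\<lambda>s. (q1, q2, s, q4)) has_derivative (\<lambda>s. (0, 0, s, 0))) (at q3)"
      by (auto intro!: derivative_eq_intros simp: zero_prod_def)
    from diff_chain_at[OF this D[unfolded q]] show ?thesis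
      by (simp add: o_def has_field_derivative_def lin)
  qed
  have 4: "((\<lambda>s. g x (q1, q2, q3, s)) has_real_derivative D (0, 0, 0, 1)) (at q4)"
  proof -
    have lin: "(\<lambda>s. D (0, 0, 0, s)) = (*) (D (0, 0, 0, 1))"
    proof
      fix s show "D (0, 0, 0, s) = D (0, 0, 0, 1) * s"
        using D.scale[of s "(0, 0, 0, 1)"] by (simp only: scaleR_Pair real_scaleR_def mult_zero_left mult_1_left mult.commute)
    qed
    have "((\<lambda>s. (q1, q2, q3, s)) has_derivative (\<lambda>s. (0, 0, 0, s))) (at q4)"
      by (auto intro!: derivative_eq_intros simp: zero_prod_def)
    from diff_chain_at[OF this D[unfolded q]] show ?thesis
      by (simp add: o_def has_field_derivative_def lin)
  qed
  have "D p = grad_pairing (g x) q p" for p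
  proof -
    obtain p1 p2 p3 p4 where p: "p = (p1, p2, p3, p4)"
      by (cases p) auto
    have "p = p1 *\<^sub>R (1, 0, 0, 0) + p2 *\<^sub>R (0, 1, 0, 0) + p3 *\<^sub>R (0, 0, 1, 0) + p4 *\<^sub>R (0, 0, 0, 1)"
      by (simp add: p)
    then have "D p = D (p1 *\<^sub>R (1, 0, 0, 0) + p2 *\<^sub>R (0, 1, 0, 0) + p3 *\<^sub>R (0, 0, 1, 0) + p4 *\<^sub>R (0, 0, 0, 1))"
      by (rule arg_cong)
    also have "\<dots> = p1 * D (1, 0, 0, 0) + p2 * D (0, 1, 0, 0) + p3 * D (0, 0, 1, 0) + p4 * D (0, 0, 0, 1)"
      by (simp only: D.add D.scale real_scaleR_def)
    also have "\<dots> = grad_pairing (g x) q p"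
      using 1[THEN DERIV_imp_deriv] 2[THEN DERIV_imp_deriv]
        3[THEN DERIV_imp_deriv] 4[THEN DERIV_imp_deriv]
      by (simp add: p q grad_pairing_def dq1_def dq2_def dq3_def dq4_def)
    finally show ?thesis .
  qed
  then have "D = grad_pairing (g x) q" ..
  with D show ?thesis by simp
qed

lemma grad_pairing_has_directional_derivative:
  assumes "numerical_hamiltonian H g"
  shows "((\<lambda>t. g x (q + t *\<^sub>R p)) has_real_derivative grad_pairing (g x) q p) (at 0)"
proof -
  let ?l = "\<lambda>t::real. q + t *\<^sub>R p"
  have "(?l has_derivative (\<lambda>t. t *\<^sub>R p)) (at 0)"
    by (auto intro!: derivative_eq_intros)
  moreover have "(g x has_derivative grad_pairing (g x) q) (at (?l 0))"
    using grad_pairing_has_derivative[OF assms] by simp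
  ultimately have "((g x \<circ> ?l) has_derivative (grad_pairing (g x) q \<circ> (\<lambda>t. t *\<^sub>R p))) (at 0)"
    by (rule diff_chain_at)
  moreover have "(grad_pairing (g x) q \<circ> (\<lambda>t. t *\<^sub>R p)) = (*) (grad_pairing (g x) q p)"
    by (intro ext, cases p) (simp add: grad_pairing_def algebra_simps)
  ultimately show ?thesis
    by (simp add: has_field_derivative_def o_def)
qed

text \<open>Along the line through \<open>q\<close> and \<open>p\<close> the function is convex in
  one real variable, so it lies above its tangent at 0; this is evaluated at 1.\<close>

lemma grad_pairing_le_diff:
  assumes "numerical_hamiltonian H g"
  shows "grad_pairing (g x) q (p - q) \<le> g x p - g x q"
proof -
  let ?l = "\<lambda>t::real. q + t *\<^sub>R (p - q)"
  have conv: "convex_on UNIV (g x)"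
    using assms unfolding numerical_hamiltonian_def by blast
  have "convex_on UNIV (\<lambda>t. g x (?l t))"
  proof (rule convex_onI)
    fix t a b :: real
    assume "0 < t" "t < 1"
    moreover have "?l ((1 - t) *\<^sub>R a + t *\<^sub>R b) = (1 - t) *\<^sub>R ?l a + t *\<^sub>R ?l b"
      by (simp add: algebra_simps)
    ultimately show "g x (?l ((1 - t) *\<^sub>R a + t *\<^sub>R b)) \<le> (1 - t) * g x (?l a) + t * g x (?l b)"
      using convex_onD[OF conv, of t "?l a" "?l b"] by simp
  qed simp
  moreover have "((\<lambda>t. g x (?l t)) has_field_derivative grad_pairing (g x) q (p - q)) (at 0)"
    by (rule grad_pairing_has_directional_derivative[OF assms])
  ultimately show ?thesis
    using convex_on_imp_above_tangent[of UNIV "\<lambda>t. g x (?l t)" 0 1 "grad_pairing (g x) q (p - q)"] by simp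
qed

text \<open>The four slots are changed one at a time.\<close>

lemma numerical_hamiltonian_mono:
  assumes "numerical_hamiltonian H g" "p1 \<le> p1'" "p2' \<le> p2" "p3 \<le> p3'" "p4' \<le> p4"
  shows "g x (p1', p2', p3', p4') \<le> g x (p1, p2, p3, p4)"
proof -
  have mono: "antimono (\<lambda>s. g x (s, p2', p3', p4'))" "mono (\<lambda>s. g x (p1, s, p3', p4'))"
    "antimono (\<lambda>s. g x (p1, p2, s, p4'))" "mono (\<lambda>s. g x (p1, p2, p3, s))"
    using assms(1) unfolding numerical_hamiltonian_def by blast+
  have "g x (p1', p2', p3', p4') \<le> g x (p1, p2', p3', p4')"
    using antimonoD[OF mono(1) assms(2)] .
  also have "\<dots> \<le> g x (p1, p2, p3', p4')"
    using monoD[OF mono(2) assms(3)] .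
  also have "\<dots> \<le> g x (p1, p2, p3, p4')"
    using antimonoD[OF mono(3) assms(4)] .
  also have "\<dots> \<le> g x (p1, p2, p3, p4)"
    using monoD[OF mono(4) assms(5)] .
  finally show ?thesis .
qed

text \<open>The signs of the direction are those along which \<open>g\<close> does not decrease in
  any slot, so the directional derivative is nonnegative.\<close>

lemma grad_pairing_nonneg:
  assumes H: "numerical_hamiltonian H g" and "p1 \<le> 0" "0 \<le> p2" "p3 \<le> 0" "0 \<le> p4"
  shows "0 \<le> grad_pairing (g x) q (p1, p2, p3, p4)"
proof -
  let ?p = "(p1, p2, p3, p4)"
  obtain q1 q2 q3 q4 where q: "q = (q1, q2, q3, q4)"
    by (cases q) auto
  have "mono (\<lambda>t. g x (q + t *\<^sub>R ?p))"
  proof (rule monoI)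
    fix s t :: real
    assume "s \<le> t"
    then show "g x (q + s *\<^sub>R ?p) \<le> g x (q + t *\<^sub>R ?p)"
      using assms numerical_hamiltonian_mono[OF H]
      by (simp add: q mult_right_mono mult_right_mono_neg)
  qed
  moreover have "((\<lambda>t. g x (q + t *\<^sub>R ?p)) has_real_derivative grad_pairing (g x) q ?p) (at 0)"
    by (rule grad_pairing_has_directional_derivative[OF H])
  ultimately show ?thesis
    using mono_on_imp_deriv_nonneg[of UNIV] by simp
qed

subsection \<open>Comparison principles\<close>

text \<open>Test the inequality with the indicator \<open>S\<close> of the set where
  \<open>M\<close> is negative. After summation by parts both space terms have the favourable sign,
  so \<open>r\<close> times the sum of \<open>M * S\<close> is nonnegative; but \<open>M * S\<close>
  is minus the negative part of \<open>M\<close>, which must therefore vanish.\<close>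

lemma implicit_transport_step_nonneg:
  assumes H: "numerical_hamiltonian H g" and Nh: "Nh > 0" and "r > 0"
    and U: "U \<in> grid_functions Nh" and M: "M \<in> grid_functions Nh"
    and super: "\<And>i j. 0 \<le> r * M i j - discrete_laplacian Nh M i j - transport g Nh U M i j"
  shows "0 \<le> M i j"
proof -
  define S :: gridfun where "S i j = (if M i j < 0 then 1 else 0)" for i j
  have S: "S \<in> grid_functions Nh"
    using M by (simp add: S_def grid_functions_def)
  have per: "torus_periodic g"
    using H by (simp add: numerical_hamiltonian_def)
  have h: "mesh Nh > 0"
    using Nh by (rule mesh_pos)
  have S01: "0 \<le> S i j" "S i j \<le> 1" for i j
    by (simp_all add: S_def)
  let ?P = "\<lambda>i j. grad_pairing (g (node Nh i j)) (discrete_grad Nh U i j) (discrete_grad Nh S i j)"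
  \<comment> \<open>Where \<open>M\<close> is negative, \<open>S\<close> attains its maximum 1;
    elsewhere it attains its minimum 0. This fixes the sign of its Laplacian.\<close>
  have lap: "0 \<le> M i j * discrete_laplacian Nh S i j" for i j
  proof (cases "M i j < 0")
    case True
    then have "discrete_laplacian Nh S i j \<le> 0"
      using S01(2)[of "i + 1" j] S01(2)[of "i - 1" j] S01(2)[of i "j + 1"] S01(2)[of i "j - 1"]
      unfolding discrete_laplacian_def by (simp add: S_def[of i j])
    with True show ?thesis by (simp add: mult_nonpos_nonpos)
  next
    case False
    then have "0 \<le> discrete_laplacian Nh S i j"
      using S01(1)[of "i + 1" j] S01(1)[of "i - 1" j] S01(1)[of i "j + 1"] S01(1)[of i "j - 1"]
      unfolding discrete_laplacian_def by (intro mult_nonpos_nonpos) (simp_all add: S_def[of i j])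
    with False show ?thesis by simp
  qed
  \<comment> \<open>At a maximum of \<open>S\<close> the forward differences are nonpositive and the
    backward ones nonnegative, which is a direction of increase of \<open>g\<close>. At a minimum
    the opposite direction is one.\<close>
  have pair: "M i j * ?P i j \<le> 0" for i j
  proof (cases "M i j < 0")
    case True
    then have "0 \<le> ?P i j"
      unfolding discrete_grad_def D1_plus_def D2_plus_def
      using S01(2)[of "i + 1" j] S01(2)[of "i - 1" j] S01(2)[of i "j + 1"] S01(2)[of i "j - 1"] h
      by (intro grad_pairing_nonneg[OF H]) (simp_all add: S_def[of i j] divide_simps)
    with True show ?thesis by (simp add: mult_nonpos_nonneg)
  next
    case False
    then have "0 \<le> grad_pairing (g (node Nh i j)) (discrete_grad Nh U i j) (- discrete_grad Nh S i j)"
      unfolding discrete_grad_def D1_plus_def D2_plus_def uminus_Pair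
      using S01(1)[of "i + 1" j] S01(1)[of "i - 1" j] S01(1)[of i "j + 1"] S01(1)[of i "j - 1"] h
      by (intro grad_pairing_nonneg[OF H]) (simp_all add: S_def[of i j] divide_simps)
    with False show ?thesis by (simp add: grad_pairing_minus mult_nonneg_nonpos)
  qed
  have MS: "M i j * S i j \<le> 0" for i j
    by (simp add: S_def)
  have "0 \<le> grid_sum Nh (\<lambda>i j. (r * M i j - discrete_laplacian Nh M i j - transport g Nh U M i j) * S i j)"
    using super S01 by (intro grid_sum_nonneg) simp
  also have "\<dots> = grid_sum Nh (\<lambda>i j. r * (M i j * S i j) - discrete_laplacian Nh M i j * S i j
      - transport g Nh U M i j * S i j)"
    by (simp add: algebra_simps)
  also have "\<dots> = r * grid_sum Nh (\<lambda>i j. M i j * S i j)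
      - grid_sum Nh (\<lambda>i j. M i j * discrete_laplacian Nh S i j) + grid_sum Nh (\<lambda>i j. M i j * ?P i j)"
    by (simp only: grid_sum_diff grid_sum_cmult grid_sum_laplacian_sym[OF M S]
        grid_sum_transport_parts[OF per Nh U M S] diff_minus_eq_add)
  finally have "0 \<le> r * grid_sum Nh (\<lambda>i j. M i j * S i j)"
    using grid_sum_nonneg[of "\<lambda>i j. M i j * discrete_laplacian Nh S i j" Nh, OF lap]
      grid_sum_nonpos[of "\<lambda>i j. M i j * ?P i j" Nh, OF pair] by linarith
  then have "grid_sum Nh (\<lambda>i j. M i j * S i j) = 0"
    using \<open>r > 0\<close> grid_sum_nonpos[of "\<lambda>i j. M i j * S i j" Nh, OF MS]
    by (simp add: zero_le_mult_iff)
  then have "grid_sum Nh (\<lambda>i j. - (M i j * S i j)) = 0"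
    by (simp only: grid_sum_minus)
  moreover have "(\<lambda>i j. - (M i j * S i j)) \<in> grid_functions Nh"
    using M S by (simp add: grid_functions_def)
  ultimately have "- (M i j * S i j) = 0"
    using MS by (intro grid_sum_nonneg_eq_0D[OF _ Nh, of "\<lambda>i j. - (M i j * S i j)"]) auto
  then show ?thesis
    by (auto simp: S_def split: if_splits)
qed

text \<open>Both operators are discrete divergences: tested with the constant 1, they differentiate
  a constant. This gives conservation of mass.\<close>

lemma grid_sum_laplacian_transport_eq_0:
  assumes H: "numerical_hamiltonian H g" and Nh: "Nh > 0"
    and U: "U \<in> grid_functions Nh" and M: "M \<in> grid_functions Nh"
  shows "grid_sum Nh (discrete_laplacian Nh M) = 0" "grid_sum Nh (transport g Nh U M) = 0"
proof -
  have one: "(\<lambda>i j. 1) \<in> grid_functions Nh"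
    by (simp add: grid_functions_def)
  have per: "torus_periodic g"
    using H by (simp add: numerical_hamiltonian_def)
  show "grid_sum Nh (discrete_laplacian Nh M) = 0"
    using grid_sum_laplacian_sym[OF M one] by (simp add: discrete_laplacian_def grid_sum_def)
  show "grid_sum Nh (transport g Nh U M) = 0"
    using grid_sum_transport_parts[OF per Nh U M one]
    by (simp add: discrete_grad_def D1_plus_def D2_plus_def grad_pairing_def grid_sum_def)
qed

text \<open>At a maximum point of \<open>U - V\<close> the Laplacian of the difference is
  nonpositive, and the one-sided differences of \<open>U\<close> and \<open>V\<close> are ordered so
  that the monotonicity of \<open>g\<close> makes its value at \<open>U\<close> the larger one. Only
  the zeroth-order term is left, and it bounds the maximum by 0.\<close>

lemma Hamilton_Jacobi_comparison:
  assumes H: "numerical_hamiltonian H g" and Nh: "Nh > 0" and "r > 0"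
    and U: "U \<in> grid_functions Nh" and V: "V \<in> grid_functions Nh"
    and le: "\<And>i j. r * U i j - discrete_laplacian Nh U i j + g (node Nh i j) (discrete_grad Nh U i j)
      \<le> r * V i j - discrete_laplacian Nh V i j + g (node Nh i j) (discrete_grad Nh V i j)"
  shows "U i j \<le> V i j"
proof -
  define W where "W i j = U i j - V i j" for i j
  have W: "W \<in> grid_functions Nh"
    unfolding W_def[abs_def] using U V by (rule grid_functions_diff)
  let ?Q = "{0..<int Nh} \<times> {0..<int Nh}"
  let ?m = "Max (case_prod W ` ?Q)"
  have ne: "?Q \<noteq> {}" "finite ?Q"
    using Nh by auto
  \<comment> \<open>By periodicity the maximum over one period is global, so it also bounds
    neighbours across the edge of the period.\<close>
  have max: "W a b \<le> ?m" for a b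
  proof -
    have "(a mod int Nh, b mod int Nh) \<in> ?Q"
      using Nh by simp
    then have "W (a mod int Nh) (b mod int Nh) \<in> case_prod W ` ?Q"
      by force
    then show ?thesis
      using grid_functions_mod[OF W] ne by simp
  qed
  have "?m \<in> case_prod W ` ?Q"
    using ne by (intro Max_in) auto
  then obtain k l where kl: "?m = W k l"
    by auto
  have h: "mesh Nh > 0"
    using Nh by (rule mesh_pos)
  have nb: "W (k + 1) l \<le> W k l" "W (k - 1) l \<le> W k l" "W k (l + 1) \<le> W k l" "W k (l - 1) \<le> W k l"
    using max kl by metis+
  then have "discrete_laplacian Nh W k l \<le> 0"
    by (simp add: discrete_laplacian_def)
  then have "discrete_laplacian Nh U k l \<le> discrete_laplacian Nh V k l"
    using discrete_laplacian_diff[of Nh U V k l] by (simp add: W_def[abs_def])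
  moreover have "g (node Nh k l) (discrete_grad Nh V k l) \<le> g (node Nh k l) (discrete_grad Nh U k l)"
    unfolding discrete_grad_def D1_plus_def D2_plus_def
    by (rule numerical_hamiltonian_mono[OF H]) (use nb h in \<open>simp_all add: W_def divide_right_mono\<close>)
  ultimately have "r * W k l \<le> 0"
    using le[of k l] by (simp add: W_def algebra_simps)
  then have "W k l \<le> 0"
    using \<open>r > 0\<close> by (simp add: mult_le_0_iff)
  with max[of i j] kl show ?thesis
    by (simp add: W_def)
qed

subsection \<open>Discrete Caputo derivatives\<close>

text \<open>Concavity of the power: by the mean value theorem both increments are compared with the
  slope at \<open>x\<close>.\<close>

lemma powr_second_difference_nonpos:
  fixes x b :: real
  assumes "1 \<le> x" "0 \<le> b" "b \<le> 1"
  shows "(x + 1) powr b + (x - 1) powr b \<le> 2 * x powr b"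
proof -
  have "(x + 1) powr b - x powr b \<le> b * x powr (b - 1)"
  proof -
    have "\<exists>z. x < z \<and> z < x + 1 \<and> (x + 1) powr b - x powr b = (x + 1 - x) * (b * z powr (b - 1))"
      using assms by (intro MVT2) (auto intro!: derivative_eq_intros)
    then obtain z where "x < z" "(x + 1) powr b - x powr b = b * z powr (b - 1)"
      by auto
    moreover have "z powr (b - 1) \<le> x powr (b - 1)"
      using assms \<open>x < z\<close> by (intro powr_mono2') auto
    ultimately show ?thesis
      using assms by (simp add: mult_left_mono)
  qed
  moreover have "b * x powr (b - 1) \<le> x powr b - (x - 1) powr b"
  \<comment> \<open>For \<open>x = 1\<close> the left interval starts at 0, where the power need not
    be differentiable; there the claim reads \<open>b \<le> 1\<close>, as
    \<open>0 powr b = 0\<close>.\<close>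
  proof (cases "x = 1")
    case False
    with assms have x: "1 < x" by simp
    have "\<exists>z. x - 1 < z \<and> z < x \<and> x powr b - (x - 1) powr b = (x - (x - 1)) * (b * z powr (b - 1))"
      using x by (intro MVT2) (auto intro!: derivative_eq_intros)
    then obtain z where "x - 1 < z" "z < x" "x powr b - (x - 1) powr b = b * z powr (b - 1)"
      by auto
    moreover have "x powr (b - 1) \<le> z powr (b - 1)"
      using assms x \<open>x - 1 < z\<close> \<open>z < x\<close> by (intro powr_mono2') auto
    ultimately show ?thesis
      using assms by (simp add: mult_left_mono)
  qed (use assms in simp)
  ultimately show ?thesis by linarith
qed

text \<open>The weight at 0 is an increment of an increasing power; the others are negated second
  differences of a concave one.\<close>

lemma c_fwd_nonneg:
  assumes "0 < \<alpha>" "\<alpha> < 1" "k < n"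
  shows "0 \<le> c_fwd \<alpha> n k"
proof (cases "k = 0")
  case True
  then show ?thesis
    using assms powr_mono2[of "1 - \<alpha>" "real n - 1" "real n"] by (simp add: c_fwd_def)
next
  case False
  then show ?thesis
    using assms powr_second_difference_nonpos[of "real n - real k" "1 - \<alpha>"]
    by (simp add: c_fwd_def algebra_simps)
qed

text \<open>The sum telescopes: a partial sum is a single increment of the power, and the last one
  is \<open>1 powr (1 - \<alpha>) - 0 powr (1 - \<alpha>)\<close>. Hence a history of equal masses
  contributes just that mass.\<close>

lemma sum_c_fwd: "(\<Sum>k\<in>{0..<Suc n}. c_fwd \<alpha> (Suc n) k) = 1"
proof -
  have "(\<Sum>k\<in>{0..<Suc m}. c_fwd \<alpha> (Suc n) k)
      = (real (Suc n) - real m) powr (1 - \<alpha>) - (real n - real m) powr (1 - \<alpha>)" for m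
    by (induction m) (simp_all add: c_fwd_def algebra_simps)
  from this[of n] show ?thesis by simp
qed

lemma caputo_scale_pos:
  assumes "0 < \<alpha>" "\<alpha> < 1" "dt > 0"
  shows "caputo_scale \<alpha> dt > 0"
  using assms by (simp add: caputo_scale_def Gamma_real_pos)

lemma caputo_fwd_diff:
  "caputo_fwd \<alpha> dt (\<lambda>n i j. M n i j - M' n i j) n i j
    = caputo_fwd \<alpha> dt M n i j - caputo_fwd \<alpha> dt M' n i j"
  by (simp add: caputo_fwd_def right_diff_distrib sum_subtractf diff_divide_distrib)

lemma caputo_bwd_diff:
  "caputo_bwd \<alpha> dt N (\<lambda>n i j. U n i j - U' n i j) n i j
    = caputo_bwd \<alpha> dt N U n i j - caputo_bwd \<alpha> dt N U' n i j"
  by (simp add: caputo_bwd_def right_diff_distrib sum_subtractf diff_divide_distrib)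

text \<open>The exceptional weights of the final and the initial level meet the zero values of
  \<open>W\<close> and \<open>Z\<close>. All other weights depend on the time lag alone, so both
  history terms are one double sum over a triangle, taken in two orders.\<close>

lemma caputo_summation_by_parts:
  assumes W: "W N i j = 0" and Z: "Z 0 i j = 0"
  shows "(\<Sum>n<N. caputo_bwd \<alpha> dt N W n i j * Z (Suc n) i j)
    = (\<Sum>n<N. caputo_fwd \<alpha> dt Z (Suc n) i j * W n i j)"
proof -
  \<comment> \<open>The common weight for the lag from \<open>n\<close> to \<open>k\<close>. In the
    forward derivative it stands between the levels \<open>Suc n\<close> and \<open>Suc k\<close>,
    since \<open>Z\<close> is taken one level later than \<open>W\<close>.\<close>
  define c where "c k n = 2 * (real k - real n) powr (1 - \<alpha>) - (real k + 1 - real n) powr (1 - \<alpha>)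
     - (real k - 1 - real n) powr (1 - \<alpha>)" for k n
  have "(\<Sum>k\<in>{n + 1..N}. c_bwd \<alpha> N n k * W k i j) = (\<Sum>k\<in>{n<..<N}. c k n * W k i j)" if "n < N" for n
  proof -
    have "{n + 1..N} = insert N {n<..<N}"
      using that by auto
    then have "(\<Sum>k\<in>{n + 1..N}. c_bwd \<alpha> N n k * W k i j) = (\<Sum>k\<in>{n<..<N}. c_bwd \<alpha> N n k * W k i j)"
      using W by simp
    also have "\<dots> = (\<Sum>k\<in>{n<..<N}. c k n * W k i j)"
      by (rule sum.cong) (auto simp: c_bwd_def c_def)
    finally show ?thesis .
  qed
  then have bwd: "(\<Sum>n<N. (\<Sum>k\<in>{n + 1..N}. c_bwd \<alpha> N n k * W k i j) * Z (Suc n) i j)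
      = (\<Sum>n<N. \<Sum>k | k \<in> {..<N} \<and> n < k. c k n * W k i j * Z (Suc n) i j)"
    by (intro sum.cong refl) (auto simp: sum_distrib_right intro!: sum.cong)
  have "(\<Sum>n\<in>{0..<Suc k}. c_fwd \<alpha> (Suc k) n * Z n i j) = (\<Sum>n<k. c k n * Z (Suc n) i j)" for k
    unfolding sum.atLeast0_lessThan_Suc_shift using Z
    by (simp add: lessThan_atLeast0 c_fwd_def c_def algebra_simps)
  then have "(\<Sum>k<N. (\<Sum>n\<in>{0..<Suc k}. c_fwd \<alpha> (Suc k) n * Z n i j) * W k i j)
      = (\<Sum>k<N. \<Sum>n | n \<in> {..<N} \<and> n < k. c k n * W k i j * Z (Suc n) i j)"
    by (intro sum.cong refl) (auto simp: sum_distrib_right intro!: sum.cong)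
  also have "\<dots> = (\<Sum>n<N. \<Sum>k | k \<in> {..<N} \<and> n < k. c k n * W k i j * Z (Suc n) i j)"
    by (rule sum.swap_restrict) auto
  finally have fwd: "(\<Sum>k<N. (\<Sum>n\<in>{0..<Suc k}. c_fwd \<alpha> (Suc k) n * Z n i j) * W k i j)
      = (\<Sum>n<N. (\<Sum>k\<in>{n + 1..N}. c_bwd \<alpha> N n k * W k i j) * Z (Suc n) i j)"
    using bwd by simp
  have "(\<Sum>n<N. caputo_bwd \<alpha> dt N W n i j * Z (Suc n) i j)
      = 1 / caputo_scale \<alpha> dt * ((\<Sum>n<N. W n i j * Z (Suc n) i j)
        - (\<Sum>n<N. (\<Sum>k\<in>{n + 1..N}. c_bwd \<alpha> N n k * W k i j) * Z (Suc n) i j))"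
    unfolding caputo_bwd_def sum_subtractf[symmetric] sum_distrib_left
    by (intro sum.cong refl) (simp add: algebra_simps diff_divide_distrib)
  also have "\<dots> = (\<Sum>n<N. caputo_fwd \<alpha> dt Z (Suc n) i j * W n i j)"
    unfolding caputo_fwd_def fwd[symmetric] sum_subtractf[symmetric] sum_distrib_left
    by (intro sum.cong refl) (simp add: algebra_simps diff_divide_distrib)
  finally show ?thesis .
qed

subsection \<open>Uniqueness\<close>

text \<open>The monotonicity of the coupling is assumed for densities only, so it must be known that
  the scheme stays among them. The induction is over all earlier levels because the Caputo
  derivative remembers them all.\<close>

lemma scheme_solution_densities:
  assumes T: "T > 0" and \<alpha>: "0 < \<alpha>" "\<alpha> < 1" and Nh: "Nh > 0" and N: "N > 0"
    and H: "numerical_hamiltonian H g" and m\<^sub>0: "m\<^sub>0 \<in> torus_densities"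
    and sol: "mfg_scheme_solution g X f T \<alpha> Nh N u\<^sub>T m\<^sub>0 U M"
  shows "n \<le> N \<Longrightarrow> M n \<in> grid_densities Nh"
proof (induction n rule: less_induct)
  case (less n)
  let ?dt = "T / real N"
  define r where "r = 1 / caputo_scale \<alpha> ?dt"
  have r: "r > 0"
    using caputo_scale_pos[OF \<alpha>, of ?dt] T N by (simp add: r_def)
  have Mn: "M n \<in> grid_functions Nh"
    using sol less.prems by (simp add: mfg_scheme_solution_def)
  show ?case
  proof (cases n)
    case 0
    have "M 0 = cell_average Nh m\<^sub>0"
      using sol by (auto simp: mfg_scheme_solution_def fun_eq_iff)
    then show ?thesis
      using cell_average_in_grid_densities[OF Nh m\<^sub>0] Mn 0 by simp
  next
    case (Suc m)
    have U: "U m \<in> grid_functions Nh"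
      using sol less.prems Suc by (simp add: mfg_scheme_solution_def)
    have IH: "M k \<in> grid_densities Nh" if "k < n" for k
      using less that by simp
    have eq: "caputo_fwd \<alpha> ?dt M n i j - discrete_laplacian Nh (M n) i j
        - transport g Nh (U m) (M n) i j = 0" for i j
      using sol less.prems Suc by (simp add: mfg_scheme_solution_def)
    \<comment> \<open>Moved to the right-hand side, the history is a nonnegative source for the
      implicit step.\<close>
    have past: "0 \<le> (\<Sum>k\<in>{0..<n}. c_fwd \<alpha> n k * M k i j)" for i j
      using IH c_fwd_nonneg[OF \<alpha>] by (intro sum_nonneg mult_nonneg_nonneg) (auto simp: grid_densities_def)
    have "0 \<le> M n i j" for i j
    proof (rule implicit_transport_step_nonneg[OF H Nh r U Mn])
      fix i j
      have "r * M n i j - discrete_laplacian Nh (M n) i j - transport g Nh (U m) (M n) i j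
          = r * (\<Sum>k\<in>{0..<n}. c_fwd \<alpha> n k * M k i j)"
        using eq[of i j] by (simp add: caputo_fwd_def r_def right_diff_distrib diff_divide_distrib)
      then show "0 \<le> r * M n i j - discrete_laplacian Nh (M n) i j - transport g Nh (U m) (M n) i j"
        using r past[of i j] by simp
    qed
    \<comment> \<open>Summing the equation over the grid removes the space terms; the new mass is
      then the weighted mean of the earlier ones.\<close>
    moreover have "grid_sum Nh (M n) = 1 / (mesh Nh)\<^sup>2"
    proof -
      have mass: "grid_sum Nh (M k) = 1 / (mesh Nh)\<^sup>2" if "k < n" for k
        using IH[OF that] mesh_pos[OF Nh]
        by (simp add: grid_densities_def grid_inner_eq_grid_sum field_simps)
      have "caputo_fwd \<alpha> ?dt M n i j = discrete_laplacian Nh (M n) i j + transport g Nh (U m) (M n) i j" for i j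
        using eq[of i j] by simp
      then have "grid_sum Nh (caputo_fwd \<alpha> ?dt M n)
          = grid_sum Nh (\<lambda>i j. discrete_laplacian Nh (M n) i j + transport g Nh (U m) (M n) i j)"
        by (simp add: grid_sum_def)
      also have "\<dots> = 0"
        using grid_sum_laplacian_transport_eq_0[OF H Nh U Mn] by (simp add: grid_sum_add)
      finally have "0 = grid_sum Nh (caputo_fwd \<alpha> ?dt M n)" ..
      also have "\<dots> = r * grid_sum Nh (\<lambda>i j. M n i j - (\<Sum>k\<in>{0..<n}. c_fwd \<alpha> n k * M k i j))"
        unfolding caputo_fwd_def r_def by (rule grid_sum_cmult)
      also have "\<dots> = r * (grid_sum Nh (M n) - (\<Sum>k\<in>{0..<n}. c_fwd \<alpha> n k * grid_sum Nh (M k)))"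
        by (simp only: grid_sum_diff grid_sum_sum grid_sum_cmult)
      also have "(\<Sum>k\<in>{0..<n}. c_fwd \<alpha> n k * grid_sum Nh (M k))
          = (\<Sum>k\<in>{0..<n}. c_fwd \<alpha> n k) * (1 / (mesh Nh)\<^sup>2)"
        unfolding sum_distrib_right by (intro sum.cong) (simp_all add: mass)
      also have "\<dots> = 1 / (mesh Nh)\<^sup>2"
        by (simp only: Suc sum_c_fwd mult_1_left)
      finally show ?thesis
        using r by simp
    qed
    ultimately show ?thesis
      using Mn mesh_pos[OF Nh] by (simp add: grid_densities_def grid_inner_eq_grid_sum)
  qed
qed

text \<open>Convexity of \<open>g\<close> enters twice, linearised once at each of the two gradients and weighted by
  the respective density.\<close>

lemma Lasry_Lions_inequality:
  assumes H: "numerical_hamiltonian H g" and Nh: "Nh > 0"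
    and U: "U \<in> grid_functions Nh" and U': "U' \<in> grid_functions Nh"
    and M: "M \<in> grid_functions Nh" "\<And>i j. 0 \<le> M i j"
    and M': "M' \<in> grid_functions Nh" "\<And>i j. 0 \<le> M' i j"
  shows "grid_sum Nh (\<lambda>i j. (g (node Nh i j) (discrete_grad Nh U i j) - g (node Nh i j) (discrete_grad Nh U' i j))
        * (M i j - M' i j))
      + grid_sum Nh (\<lambda>i j. (transport g Nh U M i j - transport g Nh U' M' i j) * (U i j - U' i j)) \<le> 0"
proof -
  define W where "W i j = U i j - U' i j" for i j
  have W: "W \<in> grid_functions Nh"
    unfolding W_def[abs_def] using U U' by (rule grid_functions_diff)
  have per: "torus_periodic g"
    using H by (simp add: numerical_hamiltonian_def)
  have DW: "discrete_grad Nh W i j = discrete_grad Nh U i j - discrete_grad Nh U' i j" for i j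
    unfolding W_def[abs_def] by (rule discrete_grad_diff)
  let ?G = "\<lambda>U i j. g (node Nh i j) (discrete_grad Nh U i j)"
  let ?P = "\<lambda>U i j. grad_pairing (g (node Nh i j)) (discrete_grad Nh U i j) (discrete_grad Nh W i j)"
  have "?G U i j - ?G U' i j \<le> ?P U i j" for i j
    using grad_pairing_le_diff[OF H, of "node Nh i j" "discrete_grad Nh U i j" "discrete_grad Nh U' i j"]
      grad_pairing_minus[of "g (node Nh i j)" "discrete_grad Nh U i j" "discrete_grad Nh W i j"]
    by (simp add: DW)
  then have 1: "M i j * (?G U i j - ?G U' i j - ?P U i j) \<le> 0" for i j
    using M(2)[of i j] by (simp add: mult_nonneg_nonpos)
  have "?P U' i j \<le> ?G U i j - ?G U' i j" for i j
    using grad_pairing_le_diff[OF H, of "node Nh i j" "discrete_grad Nh U' i j" "discrete_grad Nh U i j"]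
    by (simp add: DW)
  then have 2: "M' i j * (?P U' i j - (?G U i j - ?G U' i j)) \<le> 0" for i j
    using M'(2)[of i j] by (simp add: mult_nonneg_nonpos)
  \<comment> \<open>Summation by parts moves the transport terms onto \<open>W\<close>. Regrouped by
    density, each density multiplies one of the two tangent inequalities.\<close>
  have "grid_sum Nh (\<lambda>i j. (?G U i j - ?G U' i j) * (M i j - M' i j))
      + grid_sum Nh (\<lambda>i j. (transport g Nh U M i j - transport g Nh U' M' i j) * W i j)
    = grid_sum Nh (\<lambda>i j. (?G U i j - ?G U' i j) * (M i j - M' i j))
      + (grid_sum Nh (\<lambda>i j. transport g Nh U M i j * W i j)
        - grid_sum Nh (\<lambda>i j. transport g Nh U' M' i j * W i j))"
    by (simp only: left_diff_distrib[of "transport g Nh U M _ _"] grid_sum_diff)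
  also have "\<dots> = grid_sum Nh (\<lambda>i j. (?G U i j - ?G U' i j) * (M i j - M' i j)
      - M i j * ?P U i j + M' i j * ?P U' i j)"
    unfolding grid_sum_transport_parts[OF per Nh U M(1) W] grid_sum_transport_parts[OF per Nh U' M'(1) W]
      grid_sum_add grid_sum_diff by simp
  also have "\<dots> = grid_sum Nh (\<lambda>i j. M i j * (?G U i j - ?G U' i j - ?P U i j)
      + M' i j * (?P U' i j - (?G U i j - ?G U' i j)))"
    by (rule arg_cong[where f = "grid_sum Nh"], intro ext) (simp only: ring_distribs, simp)
  also have "\<dots> \<le> 0"
    using 1 2 by (intro grid_sum_nonpos add_nonpos_nonpos)
  finally show ?thesis
    by (simp add: W_def)
qed

theorem theorem3p1:
  fixes T \<alpha> :: real and Nh N :: nat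
    and H :: "point \<Rightarrow> real \<times> real \<Rightarrow> real" and g :: "point \<Rightarrow> grad4 \<Rightarrow> real"
    and X :: "(point \<Rightarrow> real) set" and f :: "(point \<Rightarrow> real) \<Rightarrow> point \<Rightarrow> real"
    and u\<^sub>T m\<^sub>0 :: "point \<Rightarrow> real"
    and U M U' M' :: "nat \<Rightarrow> gridfun"
  assumes "T > 0" and "0 < \<alpha>" and "\<alpha> < 1" and "Nh > 0" and "N > 0"
    and "numerical_hamiltonian H g"
    and "admissible_coupling X f"
    and "torus_periodic u\<^sub>T"
    and "m\<^sub>0 \<in> torus_densities"
    and "mfg_scheme_solution g X f T \<alpha> Nh N u\<^sub>T m\<^sub>0 U M"
    and "mfg_scheme_solution g X f T \<alpha> Nh N u\<^sub>T m\<^sub>0 U' M'"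
  shows "\<forall>n\<le>N. U n = U' n \<and> M n = M' n"
proof -
  note Nh = \<open>Nh > 0\<close> and H = \<open>numerical_hamiltonian H g\<close>
  note sol = assms(10) and sol' = assms(11)
  let ?dt = "T / real N"
  let ?F = "discrete_coupling f Nh"
  define r where "r = 1 / caputo_scale \<alpha> ?dt"
  have r: "r > 0"
    using caputo_scale_pos[OF assms(2,3), of ?dt] assms(1,5) by (simp add: r_def)
  have U: "U n \<in> grid_functions Nh" "U' n \<in> grid_functions Nh" if "n \<le> N" for n
    using sol sol' that by (simp_all add: mfg_scheme_solution_def)
  have dens: "M n \<in> grid_densities Nh" "M' n \<in> grid_densities Nh" if "n \<le> N" for n
    using scheme_solution_densities[OF assms(1-6,9) sol that]
      scheme_solution_densities[OF assms(1-6,9) sol' that] by blast+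
  have hjb: "caputo_bwd \<alpha> ?dt N U n i j - discrete_laplacian Nh (U n) i j
        + g (node Nh i j) (discrete_grad Nh (U n) i j) = ?F (M (Suc n)) i j"
    and hjb': "caputo_bwd \<alpha> ?dt N U' n i j - discrete_laplacian Nh (U' n) i j
        + g (node Nh i j) (discrete_grad Nh (U' n) i j) = ?F (M' (Suc n)) i j"
    and fp: "caputo_fwd \<alpha> ?dt M (Suc n) i j - discrete_laplacian Nh (M (Suc n)) i j
        - transport g Nh (U n) (M (Suc n)) i j = 0"
    and fp': "caputo_fwd \<alpha> ?dt M' (Suc n) i j - discrete_laplacian Nh (M' (Suc n)) i j
        - transport g Nh (U' n) (M' (Suc n)) i j = 0"
    if "n < N" for n i j
    using sol sol' that by (simp_all add: mfg_scheme_solution_def)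
  have UN: "U N = U' N" and M0: "M 0 = M' 0"
    using sol sol' by (auto simp: mfg_scheme_solution_def fun_eq_iff)

  define W where "W n i j = U n i j - U' n i j" for n i j
  define Z where "Z n i j = M n i j - M' n i j" for n i j
  \<comment> \<open>Up to the factor h^2 this is the pairing in the monotonicity assumption on the
    coupling.\<close>
  define E where "E n = grid_sum Nh (\<lambda>i j. (?F (M (Suc n)) i j - ?F (M' (Suc n)) i j) * Z (Suc n) i j)" for n
  have W: "W n \<in> grid_functions Nh" if "n \<le> N" for n
    unfolding W_def[abs_def] using U[OF that] by (rule grid_functions_diff)
  have Z: "Z n \<in> grid_functions Nh" if "n \<le> N" for n
    unfolding Z_def[abs_def] using dens[OF that] by (intro grid_functions_diff) (auto simp: grid_densities_def)
  \<comment> \<open>Both equations of step \<open>n\<close> couple \<open>U n\<close> with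
    \<open>M (Suc n)\<close>, so the test functions are \<open>Z (Suc n)\<close> and
    \<open>W n\<close>.\<close>
  have E_le: "E n \<le> grid_sum Nh (\<lambda>i j. caputo_bwd \<alpha> ?dt N W n i j * Z (Suc n) i j)
      - grid_sum Nh (\<lambda>i j. caputo_fwd \<alpha> ?dt Z (Suc n) i j * W n i j)" if n: "n < N" for n
  proof -
    let ?dG = "\<lambda>i j. g (node Nh i j) (discrete_grad Nh (U n) i j) - g (node Nh i j) (discrete_grad Nh (U' n) i j)"
    let ?dB = "\<lambda>i j. transport g Nh (U n) (M (Suc n)) i j - transport g Nh (U' n) (M' (Suc n)) i j"
    have eq1: "?F (M (Suc n)) i j - ?F (M' (Suc n)) i j
        = caputo_bwd \<alpha> ?dt N W n i j - discrete_laplacian Nh (W n) i j + ?dG i j" for i j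
      unfolding W_def[abs_def] caputo_bwd_diff discrete_laplacian_diff hjb[OF n, symmetric] hjb'[OF n, symmetric]
      by simp
    have eq2: "caputo_fwd \<alpha> ?dt Z (Suc n) i j = discrete_laplacian Nh (Z (Suc n)) i j + ?dB i j" for i j
      unfolding Z_def[abs_def] caputo_fwd_diff discrete_laplacian_diff
      using fp[OF n, of i j] fp'[OF n, of i j] by simp
    have "E n = grid_sum Nh (\<lambda>i j. caputo_bwd \<alpha> ?dt N W n i j * Z (Suc n) i j)
        - grid_sum Nh (\<lambda>i j. discrete_laplacian Nh (W n) i j * Z (Suc n) i j)
        + grid_sum Nh (\<lambda>i j. ?dG i j * Z (Suc n) i j)"
      unfolding E_def eq1 grid_sum_add[symmetric] grid_sum_diff[symmetric]
      by (simp only: distrib_right left_diff_distrib)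
    moreover have "grid_sum Nh (\<lambda>i j. caputo_fwd \<alpha> ?dt Z (Suc n) i j * W n i j)
        = grid_sum Nh (\<lambda>i j. discrete_laplacian Nh (Z (Suc n)) i j * W n i j)
        + grid_sum Nh (\<lambda>i j. ?dB i j * W n i j)"
      unfolding eq2 by (simp only: distrib_right grid_sum_add)
    moreover have "grid_sum Nh (\<lambda>i j. discrete_laplacian Nh (W n) i j * Z (Suc n) i j)
        = grid_sum Nh (\<lambda>i j. discrete_laplacian Nh (Z (Suc n)) i j * W n i j)"
      using grid_sum_laplacian_sym[OF W Z] n by (simp add: mult.commute)
    moreover have "grid_sum Nh (\<lambda>i j. ?dG i j * Z (Suc n) i j) + grid_sum Nh (\<lambda>i j. ?dB i j * W n i j) \<le> 0"
      unfolding W_def Z_def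
      using U[of n] dens[of "Suc n"] n
      by (intro Lasry_Lions_inequality[OF H Nh]) (simp_all add: grid_densities_def)
    ultimately show ?thesis by linarith
  qed
  have "(\<Sum>n<N. E n) \<le> (\<Sum>n<N. grid_sum Nh (\<lambda>i j. caputo_bwd \<alpha> ?dt N W n i j * Z (Suc n) i j)
      - grid_sum Nh (\<lambda>i j. caputo_fwd \<alpha> ?dt Z (Suc n) i j * W n i j))"
    by (intro sum_mono E_le) simp
  also have "\<dots> = grid_sum Nh (\<lambda>i j. \<Sum>n<N. caputo_bwd \<alpha> ?dt N W n i j * Z (Suc n) i j)
      - grid_sum Nh (\<lambda>i j. \<Sum>n<N. caputo_fwd \<alpha> ?dt Z (Suc n) i j * W n i j)"
    by (simp only: sum_subtractf grid_sum_sum)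
  \<comment> \<open>Adjointness in time at every node: \<open>W\<close> vanishes at the final level
    and \<open>Z\<close> at the initial one, as both solutions share these data.\<close>
  also have "\<dots> = 0"
    using caputo_summation_by_parts[of W N _ _ Z] UN M0 by (simp add: W_def Z_def)
  finally have E_sum: "(\<Sum>n<N. E n) \<le> 0" .

  have strict: "M (Suc n) = M' (Suc n)" if "E n \<le> 0" "n < N" for n
  proof -
    have "grid_inner Nh (\<lambda>i j. ?F (M (Suc n)) i j - ?F (M' (Suc n)) i j) (\<lambda>i j. M (Suc n) i j - M' (Suc n) i j) \<le> 0"
      using that(1) by (simp add: grid_inner_eq_grid_sum E_def Z_def mult_nonneg_nonpos)
    then show ?thesis
      using \<open>admissible_coupling X f\<close> Nh dens[of "Suc n"] that(2) unfolding admissible_coupling_def by auto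
  qed
  \<comment> \<open>The assumption that a nonpositive pairing forces equality already contains
    monotonicity: a negative pairing would force equal densities and hence be zero.\<close>
  have E_nonneg: "0 \<le> E n" if "n < N" for n
  proof (rule ccontr)
    assume "\<not> 0 \<le> E n"
    then have "M (Suc n) = M' (Suc n)"
      using strict that by simp
    then have "E n = 0"
      by (simp add: E_def grid_sum_def)
    with \<open>\<not> 0 \<le> E n\<close> show False by simp
  qed
  have "\<forall>n\<in>{..<N}. E n = 0"
    using E_sum E_nonneg by (subst sum_nonneg_eq_0_iff[symmetric]) (auto intro!: antisym sum_nonneg)
  then have MSuc: "M (Suc n) = M' (Suc n)" if "n < N" for n
    using strict[of n] that by simp
  have M_eq: "M n = M' n" if "n \<le> N" for n
    using that M0 MSuc by (cases n) auto

  \<comment> \<open>Induction on the time left until \<open>N\<close>, as the backward derivative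
    involves all later levels.\<close>
  have U_eq: "n \<le> N \<Longrightarrow> U n = U' n" for n
  proof (induction "N - n" arbitrary: n rule: less_induct)
    case less
    show ?case
    proof (cases "n = N")
      case False
      with less.prems have n: "n < N" by simp
      have later: "U k = U' k" if "k \<in> {n + 1..N}" for k
        using less.hyps[of k] that by auto
      have "(\<Sum>k\<in>{n + 1..N}. c_bwd \<alpha> N n k * U k i j) = (\<Sum>k\<in>{n + 1..N}. c_bwd \<alpha> N n k * U' k i j)" for i j
        using later by (intro sum.cong) auto
      \<comment> \<open>Each side is the history term, which depends on later levels only. What
        remains is one stationary equation with zeroth-order coefficient \<open>r\<close>, to which
        comparison applies in both directions.\<close>
      then have bwd: "r * U n i j - caputo_bwd \<alpha> ?dt N U n i j = r * U' n i j - caputo_bwd \<alpha> ?dt N U' n i j" for i j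
        by (simp add: caputo_bwd_def r_def right_diff_distrib diff_divide_distrib)
      then have eq: "r * U n i j - discrete_laplacian Nh (U n) i j + g (node Nh i j) (discrete_grad Nh (U n) i j)
          = r * U' n i j - discrete_laplacian Nh (U' n) i j + g (node Nh i j) (discrete_grad Nh (U' n) i j)" for i j
        using hjb[OF n, of i j] hjb'[OF n, of i j] bwd[of i j] unfolding MSuc[OF n] by linarith
      have "U n i j \<le> U' n i j" "U' n i j \<le> U n i j" for i j
        using Hamilton_Jacobi_comparison[OF H Nh r U(1) U(2) eq_refl[OF eq]]
          Hamilton_Jacobi_comparison[OF H Nh r U(2) U(1) eq_refl[OF eq[symmetric]]] n by simp_all
      then show ?thesis
        by (auto simp: fun_eq_iff intro: antisym)
    qed (simp add: UN)
  qed
  show ?thesis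
    using M_eq U_eq by blast
qed

end
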